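(* Let $F_o$ and $G_o$ satisfy conditions A1 and A2, and let $\mathbf{T}_{MM}$ be an MM-estimate of the regression slopes with loss functions $\rho_1,\rho_2$ both satisfying A3, with $\rho_1\ge\rho_2$, $\rho_1\neq\rho_2$. Let $B_S(\varepsilon)$ be the maximum bias function of the S-estimate of the regression slopes with score function $\rho_1$ (and constant $b$), and let $B_{MM}(\varepsilon)$ be the maximum bias function of $\mathbf{T}_{MM}$. Assume that $$B_S(\varepsilon) < h_1^{-1}\left(\frac{\varepsilon}{1-\varepsilon}\right).$$ Then $$h_1^{-1}\left(\frac{\varepsilon}{1-\varepsilon}\right)\le B_{MM}(\varepsilon)\le h_2^{-1}\left(\frac{\varepsilon}{1-\varepsilon}\right).$$
   Context: Model. Let $(y,\mathbf{x})\in\mathbb{R}\times\mathbb{R}^p$ have joint distribution $H_o$ under which $y$ and $\mathbf{x}$ are independent, $y\sim F_o$ and $\mathbf{x}\sim G_o$ (this is the linear model $y=\alpha_o+\mathbf{x}'\boldsymbol{\theta}_o+u$ normalized, by equivariance, so that $\alpha_o=0$, $\boldsymbol{\theta}_o=\mathbf{0}$ and the scatter matrix of $\mathbf{x}$ is the identity). Conditions. A1: $F_o$ is absolutely continuous with density $f_o$ which is symmetric, continuous and strictly decreasing on $\mathbb{R}^+$. A2: $P_{G_o}(\mathbf{x}'\boldsymbol{\theta}=c)<1$ for every $\boldsymbol{\theta}\in\mathbb{R}^p$, $\boldsymbol{\theta}\ne\mathbf{0}$, and every $c\in\mathbb{R}$. A3 (for a function $\rho:\mathbb{R}\to[0,\infty)$):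 (i) $\rho$ is symmetric, nondecreasing on $[0,\infty)$, $\rho(0)=0$; (ii) $\rho$ is bounded with $\lim_{u\to\infty}\rho(u)=1$; (iii) $\rho$ has only finitely many discontinuities. Maximum bias. For $0<\varepsilon<1$, $V_\varepsilon=\{(1-\varepsilon)H_o+\varepsilon H^*: H^* \text{ any probability distribution on }\mathbb{R}^{p+1}\}$. For an $\mathbb{R}^p$-valued functional $\mathbf{T}$ (with $\mathbf{T}(H_o)=\mathbf{0}$, weakly continuous at $H_o$), the asymptotic bias at $H$ is $b(\mathbf{T},H)=\|\mathbf{T}(H)\|$ (Euclidean norm) if $\mathbf{T}(H)$ is defined and finite, and $b(\mathbf{T},H)=\infty$ otherwise; the maximum bias function is $B_{\mathbf{T}}(\varepsilon)=\sup\{b(\mathbf{T},H):H\in V_\varepsilon\}$. S-estimates. Given $\rho$ and $b\in(0,1)$, the S-estimates of intercept, slopes and scale $\{t_S(H),\mathbf{T}_S(H),\sigma_S(H)\}$ are the solution $(\alpha,\boldsymbol{\theta},\sigma)$ of the problem of minimizing $\sigma>0$ subject to $E_H[\rho((y-\alpha-\mathbf{x}'\boldsymbol{\theta})/\sigma)]\le b$. MM-estimates. Set $b=E_{F_o}\rho_1(Y)$, and let $s(H)=\sigma_S(H)$ be the S-scale based on $\rho=\rho_1$ and this $b$. The MM-estimates $\{t_{MM}(H),\mathbf{T}_{MM}(H)\}$ are the solution $(\alpha,\boldsymbol{\theta})$ minimizing $E_H[\rho_2((y-\alpha-\mathbf{x}'\boldsymbol{\theta})/s(H))]$ over $\alpha\in\mathbb{R}$,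 $\boldsymbol{\theta}\in\mathbb{R}^p$. Functions $h_1,h_2$. Let $\underline{s}=\inf_{H\in V_\varepsilon}s(H)$, $\overline{s}=\sup_{H\in V_\varepsilon}s(H)$, and for $t\ge0$, $s>0$, $$m(t,s)=\inf_{\|\boldsymbol{\theta}\|=t}\ \inf_{\alpha\in\mathbb{R}}E_{H_o}\rho_2\left(\frac{y-\alpha-\mathbf{x}'\boldsymbol{\theta}}{s}\right)-E_{H_o}\rho_2\left(\frac{y}{s}\right).$$ Define $h_1(t)=m(t,\overline{s})$ and $h_2(t)=\inf_{\underline{s}\le s\le\overline{s}}m(t,s)$. For $i=1,2$, $h_i^{-1}(v)$ denotes the $t\ge0$ with $h_i(t)=v$. The amount of contamination satisfies $0<\varepsilon<\min\{b,1-b\}$ and is such that the two inverse values at $\varepsilon/(1-\varepsilon)$ exist.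
   Formalization: It is additionally assumed that the MM-estimate is defined (the minimum is attained) at every H in V_ε; for discontinuous ρ_2, such as 1{|u|≥c}, this can fail, making B_MM(ε) infinite and the upper bound false. *)

theory Defs
  imports "HOL-Probability.Probability"
begin

definition distributions :: "'a::topological_space measure set" where
  "distributions = {M. prob_space M \<and> sets M = sets borel}"

definition cond_A1 :: "real measure \<Rightarrow> bool" where
  "cond_A1 F \<longleftrightarrow> (\<exists>f. (\<forall>y. 0 \<le> f y) \<and> F = density lborel (\<lambda>y. ennreal (f y)) \<and>
     (\<forall>y. f (- y) = f y) \<and> continuous_on UNIV f \<and> strict_antimono_on {0<..} f)"

definition cond_A2 :: "'a::euclidean_space measure \<Rightarrow> bool" where
  "cond_A2 G \<longleftrightarrow> (\<forall>\<theta> c. \<theta> \<noteq> 0 \<longrightarrow> measure G {x. x \<bullet> \<theta> = c} < 1)"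

definition cond_A3 :: "(real \<Rightarrow> real) \<Rightarrow> bool" where
  "cond_A3 \<rho> \<longleftrightarrow> (\<forall>u. 0 \<le> \<rho> u) \<and>
     (\<forall>u. \<rho> (- u) = \<rho> u) \<and> mono_on {0..} \<rho> \<and> \<rho> 0 = 0 \<and>
     bounded (range \<rho>) \<and> (\<rho> \<longlongrightarrow> 1) at_top \<and>
     finite {u. \<not> isCont \<rho> u}"

text \<open>A joint distribution of the pair (y, x) is a measure on \<open>real \<times> (real ^ 'p)\<close>. Under the
  central model y and x are independent, so it is the product of the two marginals.\<close>

definition model :: "real measure \<Rightarrow> (real ^ 'p) measure \<Rightarrow> (real \<times> (real ^ 'p)) measure" where
  "model F G = F \<Otimes>\<^sub>M G"

definition contam_nbhd :: "real \<Rightarrow> (real \<times> (real ^ 'p)) measure \<Rightarrow> (real \<times> (real ^ 'p)) measure set" where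
  "contam_nbhd \<epsilon> Ho = {H \<in> distributions. \<exists>H' \<in> distributions.
     \<forall>A \<in> sets borel. measure H A = (1 - \<epsilon>) * measure Ho A + \<epsilon> * measure H' A}"

definition mean_loss ::
  "(real \<Rightarrow> real) \<Rightarrow> (real \<times> (real ^ 'p)) measure \<Rightarrow> real \<Rightarrow> real ^ 'p \<Rightarrow> real \<Rightarrow> real" where
  "mean_loss \<rho> H \<alpha> \<theta> \<sigma> = (\<integral>z. \<rho> ((fst z - \<alpha> - snd z \<bullet> \<theta>) / \<sigma>) \<partial>H)"

definition S_solution ::
  "(real \<Rightarrow> real) \<Rightarrow> real \<Rightarrow> (real \<times> (real ^ 'p)) measure \<Rightarrow> real \<Rightarrow> real ^ 'p \<Rightarrow> real \<Rightarrow> bool" where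
  "S_solution \<rho> b H \<alpha> \<theta> \<sigma> \<longleftrightarrow> \<sigma> > 0 \<and> mean_loss \<rho> H \<alpha> \<theta> \<sigma> \<le> b \<and>
     (\<forall>\<alpha>' \<theta>' \<sigma>'. \<sigma>' > 0 \<and> mean_loss \<rho> H \<alpha>' \<theta>' \<sigma>' \<le> b \<longrightarrow> \<sigma> \<le> \<sigma>')"

text \<open>The intercept and slopes of an S-solution need not be unique, but its scale is. The value is
  only meaningful if the minimization problem has a solution.\<close>

definition S_scale :: "(real \<Rightarrow> real) \<Rightarrow> real \<Rightarrow> (real \<times> (real ^ 'p)) measure \<Rightarrow> real" where
  "S_scale \<rho> b H = (THE \<sigma>. \<exists>\<alpha> \<theta>. S_solution \<rho> b H \<alpha> \<theta> \<sigma>)"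

definition MM_solution ::
  "(real \<Rightarrow> real) \<Rightarrow> (real \<Rightarrow> real) \<Rightarrow> real \<Rightarrow> (real \<times> (real ^ 'p)) measure \<Rightarrow> real \<Rightarrow> real ^ 'p \<Rightarrow> bool"
where
  "MM_solution \<rho>1 \<rho>2 b H \<alpha> \<theta> \<longleftrightarrow> (\<exists>\<alpha>' \<theta>' \<sigma>. S_solution \<rho>1 b H \<alpha>' \<theta>' \<sigma>) \<and>
     (\<forall>\<alpha>' \<theta>'. mean_loss \<rho>2 H \<alpha> \<theta> (S_scale \<rho>1 b H) \<le> mean_loss \<rho>2 H \<alpha>' \<theta>' (S_scale \<rho>1 b H))"

text \<open>A functional returns \<open>None\<close> where the estimate is not defined. A slope estimate picks an
  arbitrary solution of its minimization problem whenever there is one.\<close>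

definition S_slope_estimate ::
  "(real \<Rightarrow> real) \<Rightarrow> real \<Rightarrow> ((real \<times> (real ^ 'p)) measure \<Rightarrow> (real ^ 'p) option) \<Rightarrow> bool" where
  "S_slope_estimate \<rho> b T \<longleftrightarrow> (\<forall>H \<in> distributions. case T H of
       Some \<theta> \<Rightarrow> \<exists>\<alpha> \<sigma>. S_solution \<rho> b H \<alpha> \<theta> \<sigma>
     | None \<Rightarrow> \<not> (\<exists>\<alpha> \<theta> \<sigma>. S_solution \<rho> b H \<alpha> \<theta> \<sigma>))"

definition MM_slope_estimate ::
  "(real \<Rightarrow> real) \<Rightarrow> (real \<Rightarrow> real) \<Rightarrow> real \<Rightarrow>
   ((real \<times> (real ^ 'p)) measure \<Rightarrow> (real ^ 'p) option) \<Rightarrow> bool" where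
  "MM_slope_estimate \<rho>1 \<rho>2 b T \<longleftrightarrow> (\<forall>H \<in> distributions. case T H of
       Some \<theta> \<Rightarrow> \<exists>\<alpha>. MM_solution \<rho>1 \<rho>2 b H \<alpha> \<theta>
     | None \<Rightarrow> \<not> (\<exists>\<alpha> \<theta>. MM_solution \<rho>1 \<rho>2 b H \<alpha> \<theta>))"

definition bias ::
  "((real \<times> (real ^ 'p)) measure \<Rightarrow> (real ^ 'p) option) \<Rightarrow> (real \<times> (real ^ 'p)) measure \<Rightarrow> ereal" where
  "bias T H = (case T H of Some \<theta> \<Rightarrow> ereal (norm \<theta>) | None \<Rightarrow> \<infinity>)"

definition max_bias ::
  "((real \<times> (real ^ 'p)) measure \<Rightarrow> (real ^ 'p) option) \<Rightarrow>
   (real \<times> (real ^ 'p)) measure \<Rightarrow> real \<Rightarrow> ereal" where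
  "max_bias T Ho \<epsilon> = (SUP H \<in> contam_nbhd \<epsilon> Ho. bias T H)"

definition scale_inf ::
  "(real \<Rightarrow> real) \<Rightarrow> real \<Rightarrow> (real \<times> (real ^ 'p)) measure \<Rightarrow> real \<Rightarrow> real" where
  "scale_inf \<rho> b Ho \<epsilon> = (INF H \<in> contam_nbhd \<epsilon> Ho. S_scale \<rho> b H)"

definition scale_sup ::
  "(real \<Rightarrow> real) \<Rightarrow> real \<Rightarrow> (real \<times> (real ^ 'p)) measure \<Rightarrow> real \<Rightarrow> real" where
  "scale_sup \<rho> b Ho \<epsilon> = (SUP H \<in> contam_nbhd \<epsilon> Ho. S_scale \<rho> b H)"

definition m_fun ::
  "(real \<Rightarrow> real) \<Rightarrow> (real \<times> (real ^ 'p)) measure \<Rightarrow> real \<Rightarrow> real \<Rightarrow> real" where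
  "m_fun \<rho> Ho t s =
     (INF \<theta> \<in> {\<theta>. norm \<theta> = t}. INF \<alpha>. mean_loss \<rho> Ho \<alpha> \<theta> s) - (\<integral>z. \<rho> (fst z / s) \<partial>Ho)"

definition h1 ::
  "(real \<Rightarrow> real) \<Rightarrow> (real \<Rightarrow> real) \<Rightarrow> real \<Rightarrow> (real \<times> (real ^ 'p)) measure \<Rightarrow> real \<Rightarrow> real \<Rightarrow> real" where
  "h1 \<rho>1 \<rho>2 b Ho \<epsilon> t = m_fun \<rho>2 Ho t (scale_sup \<rho>1 b Ho \<epsilon>)"

definition h2 ::
  "(real \<Rightarrow> real) \<Rightarrow> (real \<Rightarrow> real) \<Rightarrow> real \<Rightarrow> (real \<times> (real ^ 'p)) measure \<Rightarrow> real \<Rightarrow> real \<Rightarrow> real" where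
  "h2 \<rho>1 \<rho>2 b Ho \<epsilon> t =
     (INF s \<in> {scale_inf \<rho>1 b Ho \<epsilon> .. scale_sup \<rho>1 b Ho \<epsilon>}. m_fun \<rho>2 Ho t s)"

definition nonneg_inv :: "(real \<Rightarrow> real) \<Rightarrow> real \<Rightarrow> real" where
  "nonneg_inv h v = (THE t. t \<ge> 0 \<and> h t = v)"

end

theory Submission
  imports Defs
begin

text \<open>Since the error density is even and strictly decreasing in \<open>\<bar>y\<bar>\<close>, a reflection argument shows
  that \<open>E \<rho>((y - \<beta>) / s)\<close> is strictly increasing in \<open>\<bar>\<beta>\<bar>\<close>; averaging over the carriers, shrinking
  \<open>(\<alpha>, \<theta>)\<close> towards 0 strictly decreases the mean loss under the central model, so \<open>h1\<close> and \<open>h2\<close>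
  are strictly increasing.

  Upper bound: an MM-solution does no worse than \<open>(0, 0)\<close>, and the contaminating part of the loss
  changes by at most \<open>\<epsilon>\<close>, so the excess loss of its slope under the central model is at most
  \<open>\<epsilon> / (1 - \<epsilon>)\<close> at some scale between \<open>scale_inf\<close> and \<open>scale_sup\<close>.

  Lower bound: if all MM-slopes had norm bounded away from \<open>h1\<^sup>-\<^sup>1(\<epsilon> / (1 - \<epsilon>))\<close>, put the contamination
  exactly on a hyperplane whose slope is longer than all S- and MM-slopes, spread ever more widely.
  Both estimates then treat it as pure outliers. Hence the S-scale tends to \<open>scale_sup\<close>, while
  fitting the hyperplane exactly would give a smaller MM-loss.\<close>

section \<open>Loss functions under condition A3\<close>

lemma cond_A3_mono:
  assumes "cond_A3 \<rho>" "\<bar>u\<bar> \<le> \<bar>v\<bar>"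
  shows "\<rho> u \<le> \<rho> v"
proof -
  have ab: "\<rho> \<bar>w\<bar> = \<rho> w" for w
    using assms(1) by (cases "w \<ge> 0") (auto simp: cond_A3_def)
  have "\<rho> \<bar>u\<bar> \<le> \<rho> \<bar>v\<bar>"
    using assms by (auto simp: cond_A3_def mono_on_def)
  thus ?thesis by (simp add: ab)
qed

lemma cond_A3_nonneg: "cond_A3 \<rho> \<Longrightarrow> 0 \<le> \<rho> u"
  and cond_A3_zero: "cond_A3 \<rho> \<Longrightarrow> \<rho> 0 = 0"
  by (auto simp: cond_A3_def)

text \<open>Along the half-line the loss is nondecreasing, so it stays below its limit 1.\<close>

lemma cond_A3_le_1:
  assumes "cond_A3 \<rho>"
  shows "\<rho> u \<le> 1"
proof (rule tendsto_lowerbound)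
  show "(\<rho> \<longlongrightarrow> 1) at_top" using assms by (simp add: cond_A3_def)
  show "\<forall>\<^sub>F x in at_top. \<rho> u \<le> \<rho> x"
    using eventually_ge_at_top[of "\<bar>u\<bar>"] by eventually_elim (auto intro: cond_A3_mono[OF assms])
qed auto

lemma cond_A3_norm: "cond_A3 \<rho> \<Longrightarrow> \<bar>\<rho> u\<bar> \<le> 1"
  using cond_A3_nonneg[of \<rho> u] cond_A3_le_1[of \<rho> u] by auto

text \<open>Flattening the negative half-line makes the loss monotone, hence Borel; evenness
  recovers \<rho> by composing with the absolute value.\<close>

lemma cond_A3_measurable [measurable_dest]:
  assumes "cond_A3 \<rho>"
  shows "\<rho> \<in> borel_measurable borel"
proof -
  have "mono (\<lambda>u. \<rho> (max 0 u))"
    by (rule monoI) (auto intro!: cond_A3_mono[OF assms])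
  hence [measurable]: "(\<lambda>u. \<rho> (max 0 u)) \<in> borel_measurable borel"
    by (rule borel_measurable_mono)
  have "\<rho> = (\<lambda>u. \<rho> (max 0 \<bar>u\<bar>))"
    by (rule ext, rule antisym) (auto intro!: cond_A3_mono[OF assms])
  moreover have "(\<lambda>u. \<rho> (max 0 \<bar>u\<bar>)) \<in> borel_measurable borel"
    by measurable
  ultimately show ?thesis by simp
qed

lemma cond_A3_tendsto_1:
  assumes "cond_A3 \<rho>" "filterlim (\<lambda>n. \<bar>u n\<bar>) at_top Fl"
  shows "((\<lambda>n. \<rho> (u n)) \<longlongrightarrow> 1) Fl"
proof -
  have "((\<lambda>n. \<rho> \<bar>u n\<bar>) \<longlongrightarrow> 1) Fl"
    using assms filterlim_compose[of \<rho>] by (auto simp: cond_A3_def)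
  moreover have "\<rho> \<bar>w\<bar> = \<rho> w" for w
    by (rule antisym) (auto intro!: cond_A3_mono[OF assms(1)])
  ultimately show ?thesis by simp
qed

text \<open>Excludes the indicator of \<open>u \<noteq> 0\<close>, which satisfies A3.\<close>

definition dips :: "(real \<Rightarrow> real) \<Rightarrow> bool" where
  "dips \<rho> \<longleftrightarrow> (\<exists>d>0. \<forall>u. \<bar>u\<bar> < d \<longrightarrow> \<rho> u < 1)"

section \<open>Mean loss of a shifted error\<close>

definition shift_loss :: "real measure \<Rightarrow> (real \<Rightarrow> real) \<Rightarrow> real \<Rightarrow> real \<Rightarrow> real" where
  "shift_loss F \<rho> s \<beta> = (\<integral>y. \<rho> ((y - \<beta>) / s) \<partial>F)"

locale error_law = prob_space F for F :: "real measure" +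
  fixes f :: "real \<Rightarrow> real"
  assumes f_nonneg: "0 \<le> f y"
    and F_density: "F = density lborel (\<lambda>y. ennreal (f y))"
    and f_even: "f (- y) = f y"
    and f_cont: "continuous_on UNIV f"
    and f_antimono: "strict_antimono_on {0<..} f"
begin

lemma sets_F [simp, measurable_cong]: "sets F = sets borel"
  by (simp add: F_density)

lemma f_measurable [measurable]: "f \<in> borel_measurable borel"
  by (rule borel_measurable_continuous_onI[OF f_cont])

lemma f_decreasing:
  assumes "\<bar>x\<bar> < \<bar>y\<bar>"
  shows "f y < f x"
proof -
  have ab: "f \<bar>w\<bar> = f w" for w using f_even[of w] by (cases "w \<ge> 0") auto
  have pos: "f v < f u" if "0 < u" "u < v" for u v
    using f_antimono that by (auto simp: monotone_on_def)
  have "f \<bar>y\<bar> < f \<bar>x\<bar>"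
  proof (cases "x = 0")
    \<comment> \<open>Strict decrease is assumed on the open half-line only; continuity extends the
      comparison to the origin through the intermediate point
      \<open>\<bar>y\<bar>/2\<close>.\<close>
    case True
    have y: "0 < \<bar>y\<bar>" using assms by auto
    have "(f \<longlongrightarrow> f 0) (at_right 0)"
      using f_cont by (simp add: continuous_on_eq_continuous_at isCont_def filterlim_at_split)
    moreover have "\<forall>\<^sub>F t in at_right 0. f (\<bar>y\<bar>/2) \<le> f t"
      using eventually_at_right_less[of 0] eventually_at_right_real[of 0 "\<bar>y\<bar>/2"] y
      by (auto elim!: eventually_mono intro!: less_imp_le pos)
    ultimately have "f (\<bar>y\<bar>/2) \<le> f 0"
      by (rule tendsto_lowerbound) auto
    moreover have "f \<bar>y\<bar> < f (\<bar>y\<bar>/2)" using y by (intro pos) auto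
    ultimately show ?thesis using True by simp
  next
    case False thus ?thesis using assms by (intro pos) auto
  qed
  thus ?thesis by (simp add: ab)
qed

lemma f_pos: "0 < f y"
proof -
  have "0 \<le> f (\<bar>y\<bar> + 1)" by (rule f_nonneg)
  also have "\<dots> < f y" by (rule f_decreasing) auto
  finally show ?thesis .
qed

text \<open>A density that is positive everywhere gives \<open>F\<close> the same null sets as
  Lebesgue measure.\<close>

lemma AE_F_iff: "(AE y in F. P y) \<longleftrightarrow> (AE y in lborel. P y)"
  unfolding F_density by (subst AE_density) (auto simp: f_pos)

lemma integrable_rho:
  assumes "cond_A3 \<rho>" "g \<in> borel_measurable M" "finite_measure M"
  shows "integrable M (\<lambda>y. \<rho> (g y))"
proof (rule finite_measure.integrable_const_bound[OF assms(3)])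
  show "AE y in M. norm (\<rho> (g y)) \<le> 1" using cond_A3_norm[OF assms(1)] by simp
  show "(\<lambda>y. \<rho> (g y)) \<in> borel_measurable M"
    using measurable_compose[OF assms(2) cond_A3_measurable[OF assms(1)]] .
qed

lemma integrable_shift:
  assumes "cond_A3 \<rho>"
  shows "integrable F (\<lambda>y. \<rho> ((y - \<beta>) / s))"
  by (rule integrable_rho[OF assms]) (auto intro: finite_measure_axioms)

text \<open>Translation moves the shift from the loss to the density, whose strict decrease can then
  be exploited.\<close>

lemma shift_loss_lborel:
  assumes A3: "cond_A3 \<rho>"
  shows "integrable lborel (\<lambda>y. \<rho> (y / s) * f (y + \<beta>))"
    and "shift_loss F \<rho> s \<beta> = (\<integral>y. \<rho> (y / s) * f (y + \<beta>) \<partial>lborel)"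
proof -
  note [measurable] = cond_A3_measurable[OF A3]
  have "integrable lborel (\<lambda>y. f y *\<^sub>R \<rho> ((y - \<beta>) / s))"
    using integrable_shift[OF A3, of \<beta> s] unfolding F_density
    by (subst (asm) integrable_density) (auto simp: f_nonneg)
  from lborel_integrable_real_affine[OF this, of 1 \<beta>]
  show "integrable lborel (\<lambda>y. \<rho> (y / s) * f (y + \<beta>))"
    by (simp add: algebra_simps)
  have "shift_loss F \<rho> s \<beta> = (\<integral>y. f y *\<^sub>R \<rho> ((y - \<beta>) / s) \<partial>lborel)"
    unfolding shift_loss_def F_density by (subst integral_density) (auto simp: f_nonneg)
  also have "\<dots> = (\<integral>y. \<rho> (y / s) * f (y + \<beta>) \<partial>lborel)"
    by (subst lborel_integral_real_affine[of 1 _ \<beta>]) (auto simp: algebra_simps)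
  finally show "shift_loss F \<rho> s \<beta> = (\<integral>y. \<rho> (y / s) * f (y + \<beta>) \<partial>lborel)" .
qed

text \<open>Adding to each integral its reflected form writes twice the difference of the losses as
  the integral of \<open>P\<close>, a product of two factors of equal sign. If it vanished, the loss
  would be periodic almost everywhere, hence almost everywhere equal to its limit 1, against
  \<open>dips\<close>.\<close>

lemma shift_loss_strict:
  assumes A3: "cond_A3 \<rho>" and d: "dips \<rho>" and s: "0 < s" and \<beta>: "\<bar>\<beta>1\<bar> < \<bar>\<beta>2\<bar>"
  shows "shift_loss F \<rho> s \<beta>1 < shift_loss F \<rho> s \<beta>2"
proof (rule ccontr)
  note [measurable] = cond_A3_measurable[OF A3]
  \<comment> \<open>The reflection \<open>y \<mapsto> - c - y\<close> interchanges the densities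
    shifted by \<beta>1 and \<beta>2.\<close>
  define c where "c = \<beta>1 + \<beta>2"
  assume neg: "\<not> ?thesis"
  define P where "P y = (\<rho> (y / s) - \<rho> ((y + c) / s)) * (f (y + \<beta>2) - f (y + \<beta>1))" for y
  have reflected: "integrable lborel (\<lambda>y. \<rho> ((y + c) / s) * f (y + (c - \<beta>)))"
             "shift_loss F \<rho> s \<beta> = (\<integral>y. \<rho> ((y + c) / s) * f (y + (c - \<beta>)) \<partial>lborel)" for \<beta>
  proof -
    have r: "\<rho> ((- c - y) / s) * f (- c - y + \<beta>) = \<rho> ((y + c) / s) * f (y + (c - \<beta>))" for y
    proof -
      have "\<rho> ((- c - y) / s) = \<rho> ((y + c) / s)"
        by (rule antisym; rule cond_A3_mono[OF A3]) (auto simp: abs_minus_commute field_simps)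
      moreover have "f (- c - y + \<beta>) = f (y + (c - \<beta>))"
        using f_even[of "- c - y + \<beta>"] by (simp add: algebra_simps)
      ultimately show ?thesis by simp
    qed
    show "integrable lborel (\<lambda>y. \<rho> ((y + c) / s) * f (y + (c - \<beta>)))"
      using lborel_integrable_real_affine[OF shift_loss_lborel(1)[OF A3, of s \<beta>], of "-1" "-c"]
      by (simp add: r)
    show "shift_loss F \<rho> s \<beta> = (\<integral>y. \<rho> ((y + c) / s) * f (y + (c - \<beta>)) \<partial>lborel)"
      unfolding shift_loss_lborel(2)[OF A3]
      by (subst lborel_integral_real_affine[of "-1" _ "-c"]) (auto simp: r)
  qed
  have c1: "c - \<beta>1 = \<beta>2" "c - \<beta>2 = \<beta>1" by (auto simp: c_def)
  have P_eq: "P y = (\<rho> (y / s) * f (y + \<beta>2) + \<rho> ((y + c) / s) * f (y + (c - \<beta>2)))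
      - (\<rho> (y / s) * f (y + \<beta>1) + \<rho> ((y + c) / s) * f (y + (c - \<beta>1)))" for y
    by (simp add: P_def c1 algebra_simps)
  note ints = shift_loss_lborel(1)[OF A3] reflected(1)
  have P_int: "integrable lborel P"
    unfolding P_eq by (intro Bochner_Integration.integrable_diff Bochner_Integration.integrable_add ints)
  have P_val: "(\<integral>y. P y \<partial>lborel) = 2 * (shift_loss F \<rho> s \<beta>2 - shift_loss F \<rho> s \<beta>1)"
    unfolding P_eq
    apply (subst Bochner_Integration.integral_diff)
      apply (intro Bochner_Integration.integrable_add ints)+
    apply (subst Bochner_Integration.integral_add, (intro ints)+)+
    using shift_loss_lborel(2)[OF A3] reflected(2) by simp
  have c_pos: "0 < c * (\<beta>2 - \<beta>1)"
    using \<beta> by (simp add: c_def abs_le_square_iff[symmetric] not_le[symmetric] algebra_simps power2_eq_square[symmetric])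
  \<comment> \<open>After squaring, both comparisons depend only on the sign of
    \<open>2 * y + c\<close>, since \<open>c\<close> and \<open>\<beta>2 - \<beta>1\<close> have the
    same sign.\<close>
  have key: "\<bar>y + c\<bar> \<le> \<bar>y\<bar> \<longleftrightarrow> \<bar>y + \<beta>2\<bar> \<le> \<bar>y + \<beta>1\<bar>" for y
  proof -
    have "\<bar>y + c\<bar> \<le> \<bar>y\<bar> \<longleftrightarrow> c * (2 * y + c) \<le> 0"
      by (simp add: abs_le_square_iff power2_eq_square algebra_simps)
    also have "\<dots> \<longleftrightarrow> (\<beta>2 - \<beta>1) * (2 * y + c) \<le> 0"
      using c_pos by (simp add: mult_le_0_iff zero_less_mult_iff) linarith
    also have "\<dots> \<longleftrightarrow> \<bar>y + \<beta>2\<bar> \<le> \<bar>y + \<beta>1\<bar>"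
      by (simp add: abs_le_square_iff power2_eq_square c_def algebra_simps)
    finally show ?thesis .
  qed
  have f_le: "f u \<le> f v" if "\<bar>v\<bar> \<le> \<bar>u\<bar>" for u v
  proof (cases "\<bar>v\<bar> = \<bar>u\<bar>")
    case True thus ?thesis using f_even[of v] by (auto simp: abs_eq_iff)
  next
    case False thus ?thesis using that by (intro less_imp_le f_decreasing) auto
  qed
  have P_nonneg: "0 \<le> P y" for y
  proof (cases "\<bar>y + c\<bar> \<le> \<bar>y\<bar>")
    case True
    have "\<rho> ((y + c) / s) \<le> \<rho> (y / s)"
      using True s by (intro cond_A3_mono[OF A3]) (simp add: abs_divide divide_right_mono)
    moreover have "f (y + \<beta>1) \<le> f (y + \<beta>2)" using True key f_le by auto
    ultimately show ?thesis by (simp add: P_def)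
  next
    case False
    have "\<rho> (y / s) \<le> \<rho> ((y + c) / s)"
      using False s by (intro cond_A3_mono[OF A3]) (simp add: abs_divide divide_right_mono)
    moreover have "f (y + \<beta>2) \<le> f (y + \<beta>1)" using False key[of y] f_le by auto
    ultimately show ?thesis by (simp add: P_def mult_nonpos_nonpos)
  qed
  have "(\<integral>y. P y \<partial>lborel) = 0"
  proof (rule antisym)
    show "(\<integral>y. P y \<partial>lborel) \<le> 0" using neg P_val by simp
    show "0 \<le> (\<integral>y. P y \<partial>lborel)" by (intro integral_nonneg_AE) (simp add: P_nonneg)
  qed
  hence "AE y in lborel. P y = 0"
    using integral_nonneg_eq_0_iff_AE[OF P_int] P_nonneg by auto
  moreover have "AE y in lborel. y \<noteq> - c / 2"
    by (rule AE_lborel_singleton)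
  \<comment> \<open>Away from the fixed point \<open>- c / 2\<close> of the reflection the density
    factor is nonzero, so the loss factor must vanish.\<close>
  ultimately have per: "AE y in lborel. \<rho> (y / s) = \<rho> ((y + c) / s)"
  proof eventually_elim
    case (elim y)
    have "\<bar>y + \<beta>2\<bar> \<noteq> \<bar>y + \<beta>1\<bar>"
      using elim(2) \<beta> by (auto simp: abs_eq_iff c_def)
    hence "f (y + \<beta>2) \<noteq> f (y + \<beta>1)"
      using f_decreasing[of "y + \<beta>2" "y + \<beta>1"] f_decreasing[of "y + \<beta>1" "y + \<beta>2"] by linarith
    thus ?case using elim(1) by (auto simp: P_def)
  qed
  \<comment> \<open>Translates of a null set by multiples of \<open>c\<close> are null, and there
    are countably many. So for almost every \<open>y\<close> the loss is constant along
    \<open>y\<close>, \<open>y + c\<close>, \<open>y + 2 * c\<close>, and so on, a sequence on which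
    it tends to 1.\<close>
  have "AE y in lborel. \<rho> ((real n * c + 1 * y) / s) = \<rho> ((real n * c + 1 * y + c) / s)" for n
    by (rule AE_borel_affine[where t="real n * c" and c=1]) (use per in auto)
  hence "AE y in lborel. \<forall>n. \<rho> ((real n * c + 1 * y) / s) = \<rho> ((real n * c + 1 * y + c) / s)"
    by (simp add: AE_all_countable)
  hence one: "AE y in lborel. \<rho> (y / s) = 1"
  proof eventually_elim
    case (elim y)
    have eq: "\<rho> ((real n * c + y) / s) = \<rho> (y / s)" for n
    proof (induction n)
      case (Suc n)
      thus ?case using elim[rule_format, of n] by (simp add: algebra_simps)
    qed simp
    have "(\<lambda>n. \<rho> ((real n * c + y) / s)) \<longlonglongrightarrow> 1"
    proof (rule cond_A3_tendsto_1[OF A3])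
      have c0: "c \<noteq> 0" using c_pos by auto
      have "filterlim (\<lambda>n. - (\<bar>y\<bar> / s) + \<bar>c\<bar> / s * real n) at_top sequentially"
        by (rule filterlim_tendsto_add_at_top[OF tendsto_const
              filterlim_tendsto_pos_mult_at_top[OF tendsto_const _ filterlim_real_sequentially]])
           (use c0 s in auto)
      hence "filterlim (\<lambda>n. (real n * \<bar>c\<bar> - \<bar>y\<bar>) / s) at_top sequentially"
        by (simp add: diff_divide_distrib mult.commute)
      thus "filterlim (\<lambda>n. \<bar>(real n * c + y) / s\<bar>) at_top sequentially"
      proof (rule filterlim_at_top_mono, intro always_eventually allI)
        fix n
        have "real n * \<bar>c\<bar> = \<bar>real n * c\<bar>" by (simp add: abs_mult)
        hence "real n * \<bar>c\<bar> - \<bar>y\<bar> \<le> \<bar>real n * c + y\<bar>" by linarith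
        thus "(real n * \<bar>c\<bar> - \<bar>y\<bar>) / s \<le> \<bar>(real n * c + y) / s\<bar>"
          using s by (simp add: abs_divide divide_right_mono)
      qed
    qed
    thus ?case unfolding eq by (rule LIMSEQ_unique[OF tendsto_const])
  qed
  obtain e where e: "0 < e" "\<And>u. \<bar>u\<bar> < e \<Longrightarrow> \<rho> u < 1" using d by (auto simp: dips_def)
  have "AE y in lborel. y \<notin> {0<..<e * s}"
    using one
  proof eventually_elim
    case (elim y)
    show ?case
    proof
      assume "y \<in> {0<..<e * s}"
      hence "\<bar>y / s\<bar> < e" using s by (auto simp: field_simps)
      from e(2)[OF this] elim show False by simp
    qed
  qed
  hence "emeasure lborel {0<..<e * s} = 0"
    by (subst (asm) AE_iff_null_sets[symmetric]) auto
  thus False using e s by simp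
qed

lemma shift_loss_nonneg: "cond_A3 \<rho> \<Longrightarrow> 0 \<le> shift_loss F \<rho> s \<beta>"
  unfolding shift_loss_def by (intro integral_nonneg_AE AE_I2 cond_A3_nonneg)

lemma shift_loss_le_1:
  assumes "cond_A3 \<rho>"
  shows "shift_loss F \<rho> s \<beta> \<le> 1"
  unfolding shift_loss_def
  by (intro integral_le_const integrable_shift assms AE_I2 cond_A3_le_1)

lemma shift_loss_minus:
  assumes A3: "cond_A3 \<rho>"
  shows "shift_loss F \<rho> s (- \<beta>) = shift_loss F \<rho> s \<beta>"
proof -
  have "\<rho> (- y / s) * f (- y - \<beta>) = \<rho> (y / s) * f (y + \<beta>)" for y
    using f_even[of "y + \<beta>"] A3 by (simp add: cond_A3_def)
  thus ?thesis
    unfolding shift_loss_lborel(2)[OF A3]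
    by (subst lborel_integral_real_affine[of "-1" _ 0]) auto
qed

lemma shift_loss_mono:
  assumes "cond_A3 \<rho>" "dips \<rho>" "0 < s" "\<bar>\<beta>1\<bar> \<le> \<bar>\<beta>2\<bar>"
  shows "shift_loss F \<rho> s \<beta>1 \<le> shift_loss F \<rho> s \<beta>2"
proof (cases "\<bar>\<beta>1\<bar> = \<bar>\<beta>2\<bar>")
  case True
  thus ?thesis using shift_loss_minus[OF assms(1), of s \<beta>2] by (auto simp: abs_eq_iff)
next
  case False
  thus ?thesis using assms by (intro less_imp_le shift_loss_strict) auto
qed

lemma shift_loss_antimono_scale:
  assumes A3: "cond_A3 \<rho>" and "0 < s" "s \<le> s'"
  shows "shift_loss F \<rho> s' 0 \<le> shift_loss F \<rho> s 0"
  unfolding shift_loss_def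
  using assms
  by (intro integral_mono integrable_shift A3 cond_A3_mono[OF A3])
     (auto simp: abs_divide intro!: divide_left_mono)

lemma shift_loss_measurable [measurable (raw)]:
  assumes [measurable]: "cond_A3 \<rho>" "g \<in> borel_measurable M"
  shows "(\<lambda>x. shift_loss F \<rho> s (g x)) \<in> borel_measurable M"
proof -
  note [measurable] = cond_A3_measurable[OF assms(1)]
  show ?thesis unfolding shift_loss_def by measurable
qed

lemma shift_loss_tendsto_AE:
  assumes A3: "cond_A3 \<rho>"
    and lim: "AE y in F. (\<lambda>n. \<rho> ((y - \<beta> n) / s n)) \<longlonglongrightarrow> \<rho>' y"
    and [measurable]: "\<rho>' \<in> borel_measurable borel"
  shows "(\<lambda>n. shift_loss F \<rho> (s n) (\<beta> n)) \<longlonglongrightarrow> (\<integral>y. \<rho>' y \<partial>F)"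
  unfolding shift_loss_def
proof (rule integral_dominated_convergence[where w = "\<lambda>_. 1"])
  note [measurable] = cond_A3_measurable[OF A3]
  show "\<rho>' \<in> borel_measurable F" by measurable
  show "(\<lambda>y. \<rho> ((y - \<beta> n) / s n)) \<in> borel_measurable F" for n by measurable
qed (use lim cond_A3_norm[OF A3] in auto)

text \<open>The loss may jump, but only at finitely many points; the errors \<open>y\<close> that
  hit a jump in the limit form a null set, and elsewhere the integrand converges.\<close>

lemma shift_loss_tendsto:
  assumes A3: "cond_A3 \<rho>" and s: "s \<longlonglongrightarrow> s0" "0 < s0" and \<beta>: "\<beta> \<longlonglongrightarrow> \<beta>0"
  shows "(\<lambda>n. shift_loss F \<rho> (s n) (\<beta> n)) \<longlonglongrightarrow> shift_loss F \<rho> s0 \<beta>0"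
  unfolding shift_loss_def[of F \<rho> s0]
proof (rule shift_loss_tendsto_AE[OF A3])
  note [measurable] = cond_A3_measurable[OF A3]
  show "(\<lambda>y. \<rho> ((y - \<beta>0) / s0)) \<in> borel_measurable borel" by measurable
  define D where "D = {u. \<not> isCont \<rho> u}"
  have "finite D" using A3 by (simp add: cond_A3_def D_def)
  hence "finite ((\<lambda>d. s0 * d + \<beta>0) ` D)" by simp
  hence "AE y in F. y \<notin> (\<lambda>d. s0 * d + \<beta>0) ` D"
    unfolding AE_F_iff by (intro AE_not_in finite_imp_null_set_lborel)
  thus "AE y in F. (\<lambda>n. \<rho> ((y - \<beta> n) / s n)) \<longlonglongrightarrow> \<rho> ((y - \<beta>0) / s0)"
  proof eventually_elim
    case (elim y)
    have "(y - \<beta>0) / s0 \<notin> D"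
    proof
      assume "(y - \<beta>0) / s0 \<in> D"
      hence "s0 * ((y - \<beta>0) / s0) + \<beta>0 \<in> (\<lambda>d. s0 * d + \<beta>0) ` D" by blast
      thus False using elim s by simp
    qed
    hence "isCont \<rho> ((y - \<beta>0) / s0)" by (simp add: D_def)
    moreover have "(\<lambda>n. (y - \<beta> n) / s n) \<longlonglongrightarrow> (y - \<beta>0) / s0"
      using s by (intro tendsto_intros \<beta>) auto
    ultimately show ?case by (rule isCont_tendsto_compose)
  qed
qed

lemma shift_loss_tendsto_1:
  assumes A3: "cond_A3 \<rho>" and s: "s \<longlonglongrightarrow> s0" "0 < s0"
    and \<beta>: "filterlim (\<lambda>n. \<bar>\<beta> n\<bar>) at_top sequentially"
  shows "(\<lambda>n. shift_loss F \<rho> (s n) (\<beta> n)) \<longlonglongrightarrow> 1"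
proof -
  have "(\<lambda>n. shift_loss F \<rho> (s n) (\<beta> n)) \<longlonglongrightarrow> (\<integral>y. 1 \<partial>F)"
  proof (rule shift_loss_tendsto_AE[OF A3], intro AE_I2 cond_A3_tendsto_1[OF A3])
    fix y
    have "filterlim (\<lambda>n. - \<bar>y\<bar> + \<bar>\<beta> n\<bar>) at_top sequentially"
      by (rule filterlim_tendsto_add_at_top[OF tendsto_const \<beta>])
    hence "filterlim (\<lambda>n. \<bar>y - \<beta> n\<bar>) at_top sequentially"
      by (rule filterlim_at_top_mono) (intro always_eventually allI, linarith)
    moreover have "(\<lambda>n. 1 / \<bar>s n\<bar>) \<longlonglongrightarrow> 1 / \<bar>s0\<bar>" using s by (intro tendsto_intros) auto
    ultimately have "filterlim (\<lambda>n. 1 / \<bar>s n\<bar> * \<bar>y - \<beta> n\<bar>) at_top sequentially"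
      using s(2) by (intro filterlim_tendsto_pos_mult_at_top[where c = "1 / \<bar>s0\<bar>"]) auto
    thus "filterlim (\<lambda>n. \<bar>(y - \<beta> n) / s n\<bar>) at_top sequentially" by (simp add: abs_divide)
  qed simp
  thus ?thesis by (simp add: prob_space)
qed

text \<open>Every nonzero error becomes infinitely large relative to the shrinking scale. This is
  why widely spread contamination acts as pure outliers.\<close>

lemma shift_loss_small_scale:
  assumes A3: "cond_A3 \<rho>" and s: "0 < s"
  shows "(\<lambda>n. shift_loss F \<rho> (s / real (Suc n)) 0) \<longlonglongrightarrow> 1"
proof -
  have "(\<lambda>n. shift_loss F \<rho> (s / real (Suc n)) 0) \<longlonglongrightarrow> (\<integral>y. 1 \<partial>F)"
  proof (rule shift_loss_tendsto_AE[OF A3])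
    have "AE y in F. y \<noteq> 0" unfolding AE_F_iff by (rule AE_lborel_singleton)
    thus "AE y in F. (\<lambda>n. \<rho> ((y - 0) / (s / real (Suc n)))) \<longlonglongrightarrow> 1"
    proof eventually_elim
      case (elim y)
      have "filterlim (\<lambda>n. real (Suc n)) at_top sequentially"
        by (rule filterlim_compose[OF filterlim_real_sequentially filterlim_Suc])
      hence "filterlim (\<lambda>n. \<bar>y\<bar> / s * real (Suc n)) at_top sequentially"
        using elim s by (intro filterlim_tendsto_pos_mult_at_top[OF tendsto_const]) auto
      thus ?case
        by (intro cond_A3_tendsto_1[OF A3]) (use s in \<open>simp add: abs_divide abs_mult\<close>)
    qed
  qed simp
  thus ?thesis by (simp add: prob_space)
qed

end

section \<open>Mean loss under the central model\<close>

locale central_model = error_law F f for F f +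
  fixes G :: "(real ^ 'p) measure"
  assumes G_distribution: "G \<in> distributions" and G_A2: "cond_A2 G"
begin

sublocale G: prob_space G
  using G_distribution by (simp add: distributions_def)

lemma sets_G [simp, measurable_cong]: "sets G = sets borel"
  using G_distribution by (simp add: distributions_def)

sublocale FG: pair_prob_space F G ..

abbreviation Ho :: "(real \<times> (real ^ 'p)) measure" where "Ho \<equiv> model F G"

lemma Ho_distribution: "Ho \<in> distributions"
proof -
  have "sets Ho = sets (borel \<Otimes>\<^sub>M borel)"
    unfolding model_def by (intro sets_pair_measure_cong) simp_all
  thus ?thesis using FG.prob_space_axioms
    by (simp add: distributions_def model_def arg_cong[OF borel_prod, of sets])
qed

text \<open>By independence and Fubini, given the carriers the fit merely shifts the error by the
  fitted value, so facts about \<open>shift_loss\<close> can be averaged over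
  \<open>G\<close>.\<close>

lemma mean_loss_Ho:
  assumes A3: "cond_A3 \<rho>"
  shows "mean_loss \<rho> Ho \<alpha> \<theta> s = (\<integral>x. shift_loss F \<rho> s (\<alpha> + x \<bullet> \<theta>) \<partial>G)"
proof -
  note [measurable] = cond_A3_measurable[OF A3]
  have "integrable (F \<Otimes>\<^sub>M G) (\<lambda>(y, x). \<rho> ((y - (\<alpha> + x \<bullet> \<theta>)) / s))"
    unfolding case_prod_beta
    by (rule integrable_rho[OF A3]) (auto intro: FG.finite_measure_axioms)
  from FG.integral_snd[OF this] show ?thesis
    unfolding mean_loss_def shift_loss_def model_def
    by (simp add: case_prod_beta' diff_diff_eq)
qed

lemma integrable_shift_loss:
  assumes "cond_A3 \<rho>"
  shows "integrable G (\<lambda>x. shift_loss F \<rho> s (\<alpha> + x \<bullet> \<theta>))"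
proof (rule G.integrable_const_bound[where B = 1])
  show "AE x in G. norm (shift_loss F \<rho> s (\<alpha> + x \<bullet> \<theta>)) \<le> 1"
    using shift_loss_nonneg[OF assms] shift_loss_le_1[OF assms] by auto
  show "(\<lambda>x. shift_loss F \<rho> s (\<alpha> + x \<bullet> \<theta>)) \<in> borel_measurable G"
    using assms by measurable
qed

lemma mean_loss_Ho_zero: "cond_A3 \<rho> \<Longrightarrow> mean_loss \<rho> Ho 0 0 s = shift_loss F \<rho> s 0"
  by (simp add: mean_loss_Ho G.prob_space)

lemma mean_loss_Ho_nonneg: "cond_A3 \<rho> \<Longrightarrow> 0 \<le> mean_loss \<rho> Ho \<alpha> \<theta> s"
  unfolding mean_loss_def by (intro integral_nonneg_AE AE_I2 cond_A3_nonneg)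

lemma mean_loss_Ho_le_1: "cond_A3 \<rho> \<Longrightarrow> mean_loss \<rho> Ho \<alpha> \<theta> s \<le> 1"
  unfolding mean_loss_Ho
  by (intro G.integral_le_const integrable_shift_loss AE_I2 shift_loss_le_1)

lemma mean_loss_Ho_ge:
  assumes "cond_A3 \<rho>" "dips \<rho>" "0 < s"
  shows "shift_loss F \<rho> s 0 \<le> mean_loss \<rho> Ho \<alpha> \<theta> s"
  unfolding mean_loss_Ho[OF assms(1)]
  by (intro G.integral_ge_const integrable_shift_loss AE_I2 shift_loss_mono assms) simp

text \<open>Shrinking multiplies each fitted value by \<open>k\<close>, which strictly lowers the
  conditional loss wherever the fitted value is nonzero; by A2 this happens with positive
  probability.\<close>

lemma mean_loss_Ho_strict:
  assumes A3: "cond_A3 \<rho>" and d: "dips \<rho>" and s: "0 < s" and k: "0 \<le> k" "k < 1" and \<theta>: "\<theta> \<noteq> 0"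
  shows "mean_loss \<rho> Ho (k * \<alpha>) (k *\<^sub>R \<theta>) s < mean_loss \<rho> Ho \<alpha> \<theta> s"
  unfolding mean_loss_Ho[OF A3]
proof (rule G.integral_less_AE[where A = "{x. \<alpha> + x \<bullet> \<theta> \<noteq> 0}"])
  have scale: "k * \<alpha> + x \<bullet> (k *\<^sub>R \<theta>) = k * (\<alpha> + x \<bullet> \<theta>)" for x
    by (simp add: algebra_simps)
  show A: "{x. \<alpha> + x \<bullet> \<theta> \<noteq> 0} \<in> sets G" by measurable
  show "emeasure G {x. \<alpha> + x \<bullet> \<theta> \<noteq> 0} \<noteq> 0"
  proof
    assume "emeasure G {x. \<alpha> + x \<bullet> \<theta> \<noteq> 0} = 0"
    hence "measure G {x. \<alpha> + x \<bullet> \<theta> \<noteq> 0} = 0" by (simp add: measure_def)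
    moreover have "{x. x \<bullet> \<theta> = - \<alpha>} = space G - {x. \<alpha> + x \<bullet> \<theta> \<noteq> 0}"
      using sets_eq_imp_space_eq[OF sets_G] by auto
    ultimately have "measure G {x. x \<bullet> \<theta> = - \<alpha>} = 1"
      using G.prob_compl[OF A] by simp
    thus False using G_A2 \<theta> by (auto simp: cond_A2_def dest!: spec[of _ \<theta>] spec[of _ "-\<alpha>"])
  qed
  show "AE x\<in>{x. \<alpha> + x \<bullet> \<theta> \<noteq> 0} in G.
    shift_loss F \<rho> s (k * \<alpha> + x \<bullet> k *\<^sub>R \<theta>) \<noteq> shift_loss F \<rho> s (\<alpha> + x \<bullet> \<theta>)"
  proof (intro AE_I2 impI)
    fix x assume "x \<in> {x. \<alpha> + x \<bullet> \<theta> \<noteq> 0}"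
    hence "\<bar>k * (\<alpha> + x \<bullet> \<theta>)\<bar> < \<bar>\<alpha> + x \<bullet> \<theta>\<bar>" using k by (simp add: abs_mult)
    from shift_loss_strict[OF A3 d s this]
    show "shift_loss F \<rho> s (k * \<alpha> + x \<bullet> k *\<^sub>R \<theta>) \<noteq> shift_loss F \<rho> s (\<alpha> + x \<bullet> \<theta>)"
      unfolding scale by simp
  qed
  show "AE x in G. shift_loss F \<rho> s (k * \<alpha> + x \<bullet> k *\<^sub>R \<theta>) \<le> shift_loss F \<rho> s (\<alpha> + x \<bullet> \<theta>)"
    unfolding scale using k
    by (intro AE_I2 shift_loss_mono A3 d s) (simp add: abs_mult mult_left_le_one_le)
qed (intro integrable_shift_loss A3)+

text \<open>Every slope vector is a proper shrinkage of a nonzero one, whose loss is at most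
  1.\<close>

lemma mean_loss_Ho_less_1:
  assumes "cond_A3 \<rho>" "dips \<rho>" "0 < s"
  shows "mean_loss \<rho> Ho 0 \<theta> s < 1"
proof -
  obtain \<theta>' k where "\<theta>' \<noteq> 0" "0 \<le> k" "k < 1" "\<theta> = k *\<^sub>R \<theta>'"
  proof (cases "\<theta> = 0")
    \<comment> \<open>The zero slope is reached from an arbitrary coordinate vector by shrinking
      with factor 0.\<close>
    case True
    show ?thesis using that[of "axis undefined 1" 0] True by (simp add: axis_eq_0_iff)
  next
    case False
    show ?thesis using that[of "2 *\<^sub>R \<theta>" "1/2"] False by simp
  qed
  with mean_loss_Ho_strict[OF assms, of k \<theta>' 0] mean_loss_Ho_le_1[OF assms(1), of 0 \<theta>' s]
  show ?thesis by simp
qed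

lemma mean_loss_Ho_tendsto_AE:
  assumes A3: "cond_A3 \<rho>"
    and lim: "\<And>x. (\<lambda>n. shift_loss F \<rho> (s n) (\<alpha> n + x \<bullet> \<theta> n)) \<longlonglongrightarrow> l x"
    and [measurable]: "l \<in> borel_measurable borel"
  shows "(\<lambda>n. mean_loss \<rho> Ho (\<alpha> n) (\<theta> n) (s n)) \<longlonglongrightarrow> (\<integral>x. l x \<partial>G)"
  unfolding mean_loss_Ho[OF A3]
proof (rule integral_dominated_convergence[where w = "\<lambda>_. 1"])
  show "(\<lambda>x. shift_loss F \<rho> (s n) (\<alpha> n + x \<bullet> \<theta> n)) \<in> borel_measurable G" for n
    using A3 by measurable
  show "AE x in G. norm (shift_loss F \<rho> (s n) (\<alpha> n + x \<bullet> \<theta> n)) \<le> 1" for n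
    using shift_loss_nonneg[OF A3] shift_loss_le_1[OF A3] by auto
qed (use lim in auto)

lemma mean_loss_Ho_tendsto:
  assumes A3: "cond_A3 \<rho>" and s: "s \<longlonglongrightarrow> s0" "0 < s0" and "\<alpha> \<longlonglongrightarrow> \<alpha>0" "\<theta> \<longlonglongrightarrow> \<theta>0"
  shows "(\<lambda>n. mean_loss \<rho> Ho (\<alpha> n) (\<theta> n) (s n)) \<longlonglongrightarrow> mean_loss \<rho> Ho \<alpha>0 \<theta>0 s0"
proof -
  have "(\<lambda>x. shift_loss F \<rho> s0 (\<alpha>0 + x \<bullet> \<theta>0)) \<in> borel_measurable borel"
    using A3 by measurable
  thus ?thesis unfolding mean_loss_Ho[OF A3, of \<alpha>0]
    by (intro mean_loss_Ho_tendsto_AE[OF A3] shift_loss_tendsto[OF A3 s] tendsto_intros assms)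
qed

lemma mean_loss_Ho_tendsto_1:
  assumes A3: "cond_A3 \<rho>" and s: "s \<longlonglongrightarrow> s0" "0 < s0" and \<theta>: "\<theta> \<longlonglongrightarrow> \<theta>0"
    and \<alpha>: "filterlim (\<lambda>n. \<bar>\<alpha> n\<bar>) at_top sequentially"
  shows "(\<lambda>n. mean_loss \<rho> Ho (\<alpha> n) (\<theta> n) (s n)) \<longlonglongrightarrow> 1"
proof -
  have "(\<lambda>n. mean_loss \<rho> Ho (\<alpha> n) (\<theta> n) (s n)) \<longlonglongrightarrow> (\<integral>x. 1 \<partial>G)"
  proof (rule mean_loss_Ho_tendsto_AE[OF A3], rule shift_loss_tendsto_1[OF A3 s])
    fix x
    have "(\<lambda>n. - \<bar>x \<bullet> \<theta> n\<bar>) \<longlonglongrightarrow> - \<bar>x \<bullet> \<theta>0\<bar>" by (intro tendsto_intros \<theta>)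
    from filterlim_tendsto_add_at_top[OF this \<alpha>]
    show "filterlim (\<lambda>n. \<bar>\<alpha> n + x \<bullet> \<theta> n\<bar>) at_top sequentially"
      by (rule filterlim_at_top_mono) (intro always_eventually allI, linarith)
  qed simp
  thus ?thesis by (simp add: G.prob_space)
qed

end

section \<open>Excess loss and strict monotonicity of its infimum\<close>

text \<open>Treats \<open>h1\<close> and \<open>h2\<close> together: \<open>S\<close> is the
  singleton of the largest scale for \<open>h1\<close>, and the whole interval of scales for
  \<open>h2\<close>.\<close>

definition inf_m :: "(real \<Rightarrow> real) \<Rightarrow> (real \<times> (real ^ 'p)) measure \<Rightarrow> real set \<Rightarrow> real \<Rightarrow> real" where
  "inf_m \<rho> H S t = (INF s\<in>S. m_fun \<rho> H t s)"

context central_model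
begin

definition excess :: "(real \<Rightarrow> real) \<Rightarrow> real \<Rightarrow> real ^ 'p \<Rightarrow> real \<Rightarrow> real" where
  "excess \<rho> \<alpha> \<theta> s = mean_loss \<rho> Ho \<alpha> \<theta> s - mean_loss \<rho> Ho 0 0 s"

lemma bdd_below_mean_loss:
  assumes "cond_A3 \<rho>"
  shows "bdd_below (range (\<lambda>\<alpha>. mean_loss \<rho> Ho \<alpha> \<theta> s))"
    and "bdd_below ((\<lambda>\<theta>. INF \<alpha>. mean_loss \<rho> Ho \<alpha> \<theta> s) ` A)"
  by (auto intro!: bdd_belowI[of _ 0] cINF_greatest mean_loss_Ho_nonneg assms)

lemma m_fun_eq:
  "m_fun \<rho> Ho t s = (INF \<theta>\<in>{\<theta>. norm \<theta> = t}. INF \<alpha>. mean_loss \<rho> Ho \<alpha> \<theta> s) - mean_loss \<rho> Ho 0 0 s"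
  by (simp add: m_fun_def mean_loss_def)

lemma m_fun_le:
  assumes "cond_A3 \<rho>"
  shows "m_fun \<rho> Ho (norm \<theta>) s \<le> excess \<rho> \<alpha> \<theta> s"
proof -
  have "(INF \<theta>\<in>{\<theta>'. norm \<theta>' = norm \<theta>}. INF \<alpha>. mean_loss \<rho> Ho \<alpha> \<theta> s) \<le> (INF \<alpha>. mean_loss \<rho> Ho \<alpha> \<theta> s)"
    by (intro cINF_lower bdd_below_mean_loss assms) simp
  also have "\<dots> \<le> mean_loss \<rho> Ho \<alpha> \<theta> s"
    by (intro cINF_lower bdd_below_mean_loss assms) simp
  finally show ?thesis by (simp add: m_fun_eq excess_def)
qed

lemma m_fun_less_obtain:
  assumes "cond_A3 \<rho>" "0 \<le> t" "m_fun \<rho> Ho t s < v"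
  obtains \<alpha> \<theta> where "norm \<theta> = t" "excess \<rho> \<alpha> \<theta> s < v"
proof -
  have "(INF \<theta>\<in>{\<theta>. norm \<theta> = t}. INF \<alpha>. mean_loss \<rho> Ho \<alpha> \<theta> s) < v + mean_loss \<rho> Ho 0 0 s"
    using assms(3) by (simp add: m_fun_eq)
  \<comment> \<open>Spheres of nonnegative radius are nonempty, so the infimum is approached by
    actual slopes.\<close>
  then obtain \<theta> where \<theta>: "norm \<theta> = t" "(INF \<alpha>. mean_loss \<rho> Ho \<alpha> \<theta> s) < v + mean_loss \<rho> Ho 0 0 s"
    using vector_choose_size[OF assms(2), where ?'a = "real ^ 'p"] bdd_below_mean_loss(2)[OF assms(1)]
    by (subst (asm) cINF_less_iff) auto
  then obtain \<alpha> where "mean_loss \<rho> Ho \<alpha> \<theta> s < v + mean_loss \<rho> Ho 0 0 s"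
    using bdd_below_mean_loss(1)[OF assms(1)] by (subst (asm) cINF_less_iff) auto
  thus ?thesis using that[of \<theta> \<alpha>] \<theta> by (simp add: excess_def)
qed

lemma bdd_below_m_fun:
  assumes A3: "cond_A3 \<rho>" and t: "0 \<le> t"
  shows "bdd_below (m_fun \<rho> Ho t ` S)"
proof (rule bdd_belowI2)
  fix s
  have "0 \<le> (INF \<theta>\<in>{\<theta>. norm \<theta> = t}. INF \<alpha>. mean_loss \<rho> Ho \<alpha> \<theta> s)"
    using vector_choose_size[OF t, where ?'a = "real ^ 'p"]
    by (intro cINF_greatest mean_loss_Ho_nonneg A3) auto
  thus "-1 \<le> m_fun \<rho> Ho t s" using mean_loss_Ho_le_1[OF A3, of 0 0 s] by (simp add: m_fun_eq)
qed

lemma inf_m_le: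
  assumes "cond_A3 \<rho>" "s \<in> S"
  shows "inf_m \<rho> Ho S (norm \<theta>) \<le> excess \<rho> \<alpha> \<theta> s"
proof -
  have "inf_m \<rho> Ho S (norm \<theta>) \<le> m_fun \<rho> Ho (norm \<theta>) s"
    unfolding inf_m_def using assms by (intro cINF_lower bdd_below_m_fun) auto
  also have "\<dots> \<le> excess \<rho> \<alpha> \<theta> s" by (rule m_fun_le[OF assms(1)])
  finally show ?thesis .
qed

lemma inf_m_less_obtain:
  assumes "cond_A3 \<rho>" "0 \<le> t" "S \<noteq> {}" "inf_m \<rho> Ho S t < v"
  obtains s \<alpha> \<theta> where "s \<in> S" "norm \<theta> = t" "excess \<rho> \<alpha> \<theta> s < v"
proof -
  obtain s where "s \<in> S" "m_fun \<rho> Ho t s < v"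
    using assms(4) bdd_below_m_fun[OF assms(1,2)] assms(3)
    unfolding inf_m_def by (subst (asm) cINF_less_iff) auto
  with m_fun_less_obtain[OF assms(1,2)] that show ?thesis by metis
qed

text \<open>The better fit is the pair \<open>(\<alpha>, \<theta>)\<close> scaled down by the common
  factor \<open>t / norm \<theta>\<close>; the loss at \<open>(0, 0)\<close> cancels.\<close>

lemma excess_strict:
  assumes A3: "cond_A3 \<rho>" and d: "dips \<rho>" and s: "0 < s" and t: "0 \<le> t" "t < norm \<theta>"
  shows "\<exists>\<alpha>' \<theta>'. norm \<theta>' = t \<and> excess \<rho> \<alpha>' \<theta>' s < excess \<rho> \<alpha> \<theta> s"
proof -
  define k where "k = t / norm \<theta>"
  have n: "norm \<theta> > 0" using t by linarith
  have k: "0 \<le> k" "k < 1" and nk: "norm (k *\<^sub>R \<theta>) = t" using t n by (auto simp: k_def)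
  have "\<theta> \<noteq> 0" using n by auto
  from mean_loss_Ho_strict[OF A3 d s k this, of \<alpha>]
  show ?thesis using nk by (intro exI[of _ "k * \<alpha>"] exI[of _ "k *\<^sub>R \<theta>"]) (simp add: excess_def)
qed

text \<open>A minimizing sequence may have intercepts tending to infinity; passing to the compact
  extended reals covers this case, where the mean loss tends to its supremum 1.\<close>

lemma inf_m_strict_mono:
  assumes A3: "cond_A3 \<rho>" and d: "dips \<rho>" and S: "compact S" "S \<noteq> {}" "S \<subseteq> {0<..}"
    and t: "0 \<le> t" "t < t'"
  shows "inf_m \<rho> Ho S t < inf_m \<rho> Ho S t'"
proof -
  define v where "v = inf_m \<rho> Ho S t'"
  have "\<exists>s \<alpha> \<theta>. s \<in> S \<and> norm \<theta> = t' \<and> excess \<rho> \<alpha> \<theta> s < v + 1 / real (Suc n)" for n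
  proof -
    have "inf_m \<rho> Ho S t' < v + 1 / real (Suc n)" by (simp add: v_def)
    moreover have "0 \<le> t'" using t by simp
    ultimately show ?thesis using inf_m_less_obtain[OF A3 _ S(2)] by metis
  qed
  then obtain s \<alpha> and \<theta> :: "nat \<Rightarrow> real ^ 'p" where
    sn: "\<And>n. s n \<in> S" and \<theta>n: "\<And>n. norm (\<theta> n) = t'"
    and ex: "\<And>n. excess \<rho> (\<alpha> n) (\<theta> n) (s n) < v + 1 / real (Suc n)"
    by metis
  have exl: "(\<lambda>n. excess \<rho> (\<alpha> n) (\<theta> n) (s n)) \<longlonglongrightarrow> v"
  proof (rule tendsto_sandwich[where f = "\<lambda>_. v" and h = "\<lambda>n. v + 1 / real (Suc n)"])
    show "(\<lambda>n. v + 1 / real (Suc n)) \<longlonglongrightarrow> v"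
      using tendsto_add[OF tendsto_const[of v] LIMSEQ_inverse_real_of_nat]
      by (simp add: inverse_eq_divide)
    show "\<forall>\<^sub>F n in sequentially. v \<le> excess \<rho> (\<alpha> n) (\<theta> n) (s n)"
      using inf_m_le[OF A3 sn] \<theta>n by (intro always_eventually allI) (metis v_def)
    show "\<forall>\<^sub>F n in sequentially. excess \<rho> (\<alpha> n) (\<theta> n) (s n) \<le> v + 1 / real (Suc n)"
      using ex by (intro always_eventually allI less_imp_le)
  qed simp
  \<comment> \<open>Scales and slopes of the minimizing sequence stay in a compact set, so a
    subsequence of them converges.\<close>
  have comp: "compact (S \<times> cball (0 :: real ^ 'p) t')" by (intro compact_Times S) simp
  have "\<exists>l\<in>S \<times> cball (0 :: real ^ 'p) t'. \<exists>r. strict_mono r \<and> ((\<lambda>n. (s n, \<theta> n)) \<circ> r) \<longlonglongrightarrow> l"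
    by (rule compact_def[THEN iffD1, rule_format, OF comp]) (simp add: sn \<theta>n)
  then obtain l r where l: "l \<in> S \<times> cball 0 t'" and r: "strict_mono r"
    and lim: "((\<lambda>n. (s n, \<theta> n)) \<circ> r) \<longlonglongrightarrow> l"
    by auto
  obtain a q where q: "strict_mono q" and a: "((\<lambda>n. ereal (\<alpha> (r n))) \<circ> q) \<longlonglongrightarrow> a"
    using compact_complete_linorder by blast
  define s0 \<theta>0 where "s0 = fst l" and "\<theta>0 = snd l"
  have rq: "strict_mono (r \<circ> q)" using r q by (rule strict_mono_o)
  have "((\<lambda>n. (s n, \<theta> n)) \<circ> r \<circ> q) \<longlonglongrightarrow> l" by (rule LIMSEQ_subseq_LIMSEQ[OF lim q])
  hence s0: "(\<lambda>n. s (r (q n))) \<longlonglongrightarrow> s0" and \<theta>0: "(\<lambda>n. \<theta> (r (q n))) \<longlonglongrightarrow> \<theta>0"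
    by (auto simp: s0_def \<theta>0_def o_def dest: tendsto_fst tendsto_snd)
  have s0S: "s0 \<in> S" using l by (auto simp: s0_def)
  hence s0p: "0 < s0" using S by auto
  have n\<theta>0: "norm \<theta>0 = t'"
    using tendsto_norm[OF \<theta>0] by (simp add: \<theta>n LIMSEQ_const_iff)
  have ex': "(\<lambda>n. excess \<rho> (\<alpha> (r (q n))) (\<theta> (r (q n))) (s (r (q n)))) \<longlonglongrightarrow> v"
    using LIMSEQ_subseq_LIMSEQ[OF exl rq] by (simp add: o_def)
  have zero: "(\<lambda>n. mean_loss \<rho> Ho 0 0 (s (r (q n)))) \<longlonglongrightarrow> mean_loss \<rho> Ho 0 0 s0"
    by (rule mean_loss_Ho_tendsto[OF A3 s0 s0p]) auto
  \<comment> \<open>If the intercepts escape, then \<open>v\<close> is the excess belonging to loss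
    1, and any slope of length \<open>t\<close> with intercept 0 already beats it.\<close>
  have unbounded: "\<exists>\<alpha>' \<theta>'. norm \<theta>' = t \<and> excess \<rho> \<alpha>' \<theta>' s0 < v"
    if "filterlim (\<lambda>n. \<bar>\<alpha> (r (q n))\<bar>) at_top sequentially"
  proof -
    from mean_loss_Ho_tendsto_1[OF A3 s0 s0p \<theta>0 that] zero
    have "(\<lambda>n. excess \<rho> (\<alpha> (r (q n))) (\<theta> (r (q n))) (s (r (q n)))) \<longlonglongrightarrow> 1 - mean_loss \<rho> Ho 0 0 s0"
      unfolding excess_def by (rule tendsto_diff)
    hence v: "v = 1 - mean_loss \<rho> Ho 0 0 s0" by (rule LIMSEQ_unique[OF ex'])
    obtain \<theta>' :: "real ^ 'p" where "norm \<theta>' = t" using vector_choose_size[OF t(1)] by auto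
    thus ?thesis using mean_loss_Ho_less_1[OF A3 d s0p, of \<theta>'] v
      by (intro exI[of _ 0] exI[of _ \<theta>']) (simp add: excess_def)
  qed
  have "\<exists>\<alpha>' \<theta>'. norm \<theta>' = t \<and> excess \<rho> \<alpha>' \<theta>' s0 < v"
  proof (cases a)
    case (real \<alpha>0)
    hence "(\<lambda>n. \<alpha> (r (q n))) \<longlonglongrightarrow> \<alpha>0" using a by (simp add: o_def)
    from mean_loss_Ho_tendsto[OF A3 s0 s0p this \<theta>0] zero
    have "(\<lambda>n. excess \<rho> (\<alpha> (r (q n))) (\<theta> (r (q n))) (s (r (q n)))) \<longlonglongrightarrow> excess \<rho> \<alpha>0 \<theta>0 s0"
      unfolding excess_def by (rule tendsto_diff)
    hence "v = excess \<rho> \<alpha>0 \<theta>0 s0" by (rule LIMSEQ_unique[OF ex'])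
    thus ?thesis using excess_strict[OF A3 d s0p t(1), of \<theta>0] t n\<theta>0 by auto
  next
    case inf: PInf
    hence "filterlim (\<lambda>n. \<alpha> (r (q n))) at_top sequentially"
      using a by (simp add: o_def tendsto_PInfty_eq_at_top)
    thus ?thesis by (intro unbounded) (erule filterlim_at_top_mono,
      intro always_eventually allI abs_ge_self abs_ge_minus_self)
  next
    case inf: MInf
    hence "((\<lambda>n. - ereal (\<alpha> (r (q n)))) \<longlonglongrightarrow> - (- \<infinity>))"
      using a by (intro tendsto_uminus_ereal) (simp add: o_def)
    hence "filterlim (\<lambda>n. - \<alpha> (r (q n))) at_top sequentially"
      by (simp add: tendsto_PInfty_eq_at_top)
    thus ?thesis by (intro unbounded) (erule filterlim_at_top_mono,
      intro always_eventually allI abs_ge_self abs_ge_minus_self)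
  qed
  then obtain \<alpha>' \<theta>' where "norm \<theta>' = t" "excess \<rho> \<alpha>' \<theta>' s0 < v" by auto
  with inf_m_le[OF A3 s0S, of \<theta>' \<alpha>'] show ?thesis by (simp add: v_def)
qed

text \<open>Strict monotonicity makes the solution unique, so the definite description picks
  it.\<close>

lemma nonneg_inv_inf_m:
  assumes "cond_A3 \<rho>" "dips \<rho>" "compact S" "S \<noteq> {}" "S \<subseteq> {0<..}" "0 \<le> t"
  shows "nonneg_inv (inf_m \<rho> Ho S) (inf_m \<rho> Ho S t) = t"
  unfolding nonneg_inv_def
proof (rule the_equality)
  fix t' assume t': "0 \<le> t' \<and> inf_m \<rho> Ho S t' = inf_m \<rho> Ho S t"
  show "t' = t"
    using inf_m_strict_mono[OF assms(1-5), of t t'] inf_m_strict_mono[OF assms(1-5), of t' t] t' assms(6)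
    by (metis less_irrefl linorder_neqE_linordered_idom)
qed (use assms in auto)

end

section \<open>Contaminated distributions as mixtures\<close>

text \<open>Two-stage sampling: a coin with success probability \<epsilon> selects \<open>Q\<close>,
  otherwise \<open>P\<close>. The monadic form yields a measure together with its integration
  rule.\<close>

definition mixture :: "real \<Rightarrow> 'a::topological_space measure \<Rightarrow> 'a measure \<Rightarrow> 'a measure" where
  "mixture \<epsilon> P Q = measure_pmf (bernoulli_pmf \<epsilon>) \<bind> (\<lambda>b. if b then Q else P)"

lemma mixture_measurable:
  fixes P Q :: "'a::topological_space measure"
  assumes "P \<in> distributions" "Q \<in> distributions"
  shows "(\<lambda>b. if b then Q else P) \<in> measurable (measure_pmf (bernoulli_pmf \<epsilon>)) (subprob_algebra borel)"
proof -
  have "M \<in> space (subprob_algebra borel)" if "M \<in> distributions" for M :: "'a measure"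
    using that prob_space_imp_subprob_space[of M] by (simp add: distributions_def space_subprob_algebra)
  thus ?thesis using assms by (simp add: measurable_pmf_measure1 Pi_def)
qed

lemma mixture_distribution:
  assumes "P \<in> distributions" "Q \<in> distributions"
  shows "mixture \<epsilon> P Q \<in> distributions"
proof -
  have "prob_space (mixture \<epsilon> P Q)"
    unfolding mixture_def
    by (rule measure_pmf.prob_space_bind[OF _ mixture_measurable[OF assms]])
       (use assms in \<open>auto simp: distributions_def\<close>)
  moreover have "sets (mixture \<epsilon> P Q) = sets borel"
    unfolding mixture_def
    by (rule sets_bind) (use assms in \<open>auto simp: distributions_def\<close>)
  ultimately show ?thesis by (simp add: distributions_def)
qed

lemma nn_integral_mixture:
  assumes "P \<in> distributions" "Q \<in> distributions" "0 \<le> \<epsilon>" "\<epsilon> \<le> 1" "g \<in> borel_measurable borel"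
  shows "(\<integral>\<^sup>+x. g x \<partial>mixture \<epsilon> P Q) = ennreal (1 - \<epsilon>) * (\<integral>\<^sup>+x. g x \<partial>P) + ennreal \<epsilon> * (\<integral>\<^sup>+x. g x \<partial>Q)"
  unfolding mixture_def
  by (subst nn_integral_bind[OF assms(5) mixture_measurable[OF assms(1,2)]])
     (use assms in \<open>simp add: mult.commute add.commute ennreal_minus\<close>)

text \<open>The bounds on \<open>g\<close> make it integrable under all three laws, so the identity
  carries over from nonnegative integrals.\<close>

lemma integral_mixture:
  fixes g :: "'a::topological_space \<Rightarrow> real"
  assumes P: "P \<in> distributions" and Q: "Q \<in> distributions" and \<epsilon>: "0 \<le> \<epsilon>" "\<epsilon> \<le> 1"
    and g: "g \<in> borel_measurable borel" "\<And>x. 0 \<le> g x" "\<And>x. g x \<le> 1"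
  shows "(\<integral>x. g x \<partial>mixture \<epsilon> P Q) = (1 - \<epsilon>) * (\<integral>x. g x \<partial>P) + \<epsilon> * (\<integral>x. g x \<partial>Q)"
proof -
  have int: "ennreal (\<integral>x. g x \<partial>M) = (\<integral>\<^sup>+x. g x \<partial>M)" if "M \<in> distributions" for M
  proof -
    interpret prob_space M using that by (simp add: distributions_def)
    have "g \<in> borel_measurable M"
      using g(1) that measurable_cong_sets[of M borel] by (auto simp: distributions_def)
    hence "integrable M g" by (intro integrable_const_bound[of _ 1]) (auto simp: g)
    thus ?thesis by (subst nn_integral_eq_integral) (auto simp: g)
  qed
  have nn: "0 \<le> (\<integral>x. g x \<partial>M)" for M by (intro integral_nonneg_AE) (simp add: g)
  have "ennreal (\<integral>x. g x \<partial>mixture \<epsilon> P Q) = ennreal ((1 - \<epsilon>) * (\<integral>x. g x \<partial>P) + \<epsilon> * (\<integral>x. g x \<partial>Q))"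
    using \<epsilon> g nn
    by (simp add: int P Q mixture_distribution nn_integral_mixture ennreal_plus ennreal_mult)
  thus ?thesis using \<epsilon> by (subst (asm) ennreal_inj) (auto intro!: add_nonneg_nonneg mult_nonneg_nonneg nn)
qed

lemma measure_mixture:
  assumes "P \<in> distributions" "Q \<in> distributions" "0 \<le> \<epsilon>" "\<epsilon> \<le> 1" "A \<in> sets borel"
  shows "measure (mixture \<epsilon> P Q) A = (1 - \<epsilon>) * measure P A + \<epsilon> * measure Q A"
proof -
  have "measure M A = (\<integral>x. indicator A x \<partial>M)" if "M \<in> distributions" for M
    using that assms(5) sets_eq_imp_space_eq[of M borel] by (simp add: distributions_def)
  thus ?thesis
    using assms integral_mixture[OF assms(1-4), of "indicator A"] mixture_distribution[OF assms(1,2)]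
    by (simp add: indicator_le_1)
qed

text \<open>Probability measures that agree on Borel sets coincide, so each member of the
  neighbourhood is a mixture and its mean losses split into a central and a contaminating
  part.\<close>

lemma contam_nbhd_eq:
  assumes "Ho \<in> distributions" "0 \<le> \<epsilon>" "\<epsilon> \<le> 1"
  shows "contam_nbhd \<epsilon> Ho = mixture \<epsilon> Ho ` distributions"
proof (intro equalityI subsetI)
  fix H assume "H \<in> contam_nbhd \<epsilon> Ho"
  then obtain H' where H: "H \<in> distributions" and H': "H' \<in> distributions"
    and eq: "\<And>A. A \<in> sets borel \<Longrightarrow> measure H A = (1 - \<epsilon>) * measure Ho A + \<epsilon> * measure H' A"
    by (auto simp: contam_nbhd_def)
  let ?M = "mixture \<epsilon> Ho H'"
  have M: "?M \<in> distributions" using assms H' by (intro mixture_distribution)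
  interpret H: prob_space H using H by (simp add: distributions_def)
  interpret M: prob_space ?M using M by (simp add: distributions_def)
  have "H = ?M"
  proof (rule measure_eqI)
    fix A assume "A \<in> sets H"
    hence "A \<in> sets borel" using H by (simp add: distributions_def)
    thus "emeasure H A = emeasure ?M A"
      using eq measure_mixture[OF assms(1) H' assms(2,3)]
      by (simp add: H.emeasure_eq_measure M.emeasure_eq_measure)
  qed (use H M in \<open>simp add: distributions_def\<close>)
  thus "H \<in> mixture \<epsilon> Ho ` distributions" using H' by simp
next
  fix H assume "H \<in> mixture \<epsilon> Ho ` distributions"
  thus "H \<in> contam_nbhd \<epsilon> Ho"
    using assms by (auto simp: contam_nbhd_def measure_mixture mixture_distribution)
qed

lemma residual_loss_measurable:
  fixes \<theta> :: "real ^ 'p"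
  assumes "cond_A3 \<rho>"
  shows "(\<lambda>z. \<rho> ((fst z - \<alpha> - snd z \<bullet> \<theta>) / \<sigma>)) \<in> borel_measurable borel"
proof (rule measurable_compose[OF _ cond_A3_measurable[OF assms]])
  have "continuous_on UNIV (\<lambda>z :: real \<times> (real ^ 'p). fst z - \<alpha> - snd z \<bullet> \<theta>)"
    by (intro continuous_intros)
  from borel_measurable_continuous_onI[OF this]
  show "(\<lambda>z :: real \<times> (real ^ 'p). (fst z - \<alpha> - snd z \<bullet> \<theta>) / \<sigma>) \<in> borel_measurable borel"
    by (rule borel_measurable_divide) simp
qed

lemma mean_loss_mixture:
  assumes "P \<in> distributions" "Q \<in> distributions" "0 \<le> \<epsilon>" "\<epsilon> \<le> 1" and A3: "cond_A3 \<rho>"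
  shows "mean_loss \<rho> (mixture \<epsilon> P Q) \<alpha> \<theta> \<sigma> =
    (1 - \<epsilon>) * mean_loss \<rho> P \<alpha> \<theta> \<sigma> + \<epsilon> * mean_loss \<rho> Q \<alpha> \<theta> \<sigma>"
  unfolding mean_loss_def
  by (rule integral_mixture[OF assms(1-4) residual_loss_measurable[OF A3]])
     (simp_all add: cond_A3_nonneg[OF A3] cond_A3_le_1[OF A3])

lemma mean_loss_bounds:
  assumes "Q \<in> distributions" and A3: "cond_A3 \<rho>"
  shows "0 \<le> mean_loss \<rho> Q \<alpha> \<theta> \<sigma>" "mean_loss \<rho> Q \<alpha> \<theta> \<sigma> \<le> 1"
proof -
  interpret prob_space Q using assms by (simp add: distributions_def)
  have sets: "sets Q = sets borel" using assms by (simp add: distributions_def)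
  have "integrable Q (\<lambda>z. \<rho> ((fst z - \<alpha> - snd z \<bullet> \<theta>) / \<sigma>))"
  proof (rule integrable_const_bound[where B = 1])
    show "(\<lambda>z. \<rho> ((fst z - \<alpha> - snd z \<bullet> \<theta>) / \<sigma>)) \<in> borel_measurable Q"
      using residual_loss_measurable[OF A3] by (simp cong: measurable_cong_sets add: sets)
  qed (simp add: cond_A3_norm[OF A3])
  thus "mean_loss \<rho> Q \<alpha> \<theta> \<sigma> \<le> 1"
    unfolding mean_loss_def by (intro integral_le_const AE_I2 cond_A3_le_1[OF A3])
  show "0 \<le> mean_loss \<rho> Q \<alpha> \<theta> \<sigma>"
    unfolding mean_loss_def by (intro integral_nonneg_AE AE_I2 cond_A3_nonneg[OF A3])
qed

text \<open>Of two solutions, each is feasible in the problem that the other minimizes, so their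
  scales agree.\<close>

lemma S_scale_eq:
  assumes "S_solution \<rho> b H \<alpha> \<theta> \<sigma>"
  shows "S_scale \<rho> b H = \<sigma>"
  unfolding S_scale_def
proof (rule the_equality)
  fix \<sigma>' assume "\<exists>\<alpha> \<theta>. S_solution \<rho> b H \<alpha> \<theta> \<sigma>'"
  thus "\<sigma>' = \<sigma>" using assms unfolding S_solution_def by (meson antisym)
qed (use assms in blast)

section \<open>Contamination on a hyperplane\<close>

context central_model
begin

text \<open>Contamination on the hyperplane \<open>y = \<alpha> + x \<bullet> \<theta>\<close>, spread along the direction of \<open>\<theta>\<close> by the factor \<open>L\<close>.
  Reusing the error law \<open>F\<close> for the spread lets the monotonicity of \<open>shift_loss\<close> bound its loss.\<close>

definition contaminant :: "real \<Rightarrow> real \<Rightarrow> real ^ 'p \<Rightarrow> (real \<times> (real ^ 'p)) measure" where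
  "contaminant L \<alpha> \<theta> = distr F borel (\<lambda>w. (L * w * norm \<theta> + \<alpha>, (L * w) *\<^sub>R sgn \<theta>))"

lemma contaminant_measurable:
  "(\<lambda>w. (L * w * norm \<theta> + \<alpha>, (L * w) *\<^sub>R sgn (\<theta> :: real ^ 'p))) \<in> borel_measurable F"
proof -
  have "(\<lambda>w. L * w * norm \<theta> + \<alpha>) \<in> borel_measurable F" by measurable
  moreover have "(\<lambda>w. (L * w) *\<^sub>R sgn \<theta>) \<in> borel_measurable F"
    by (intro borel_measurable_scaleR) measurable
  ultimately show ?thesis by (rule borel_measurable_Pair)
qed

lemma contaminant_distribution: "contaminant L \<alpha> \<theta> \<in> distributions"
  using prob_space_distr[OF contaminant_measurable]
  by (simp add: contaminant_def distributions_def)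

text \<open>On the line that carries the contamination, the residual of any fit is affine in
  \<open>w\<close>; its coefficient is governed by the slope gap in the direction of
  \<theta>0.\<close>

lemma mean_loss_contaminant:
  assumes A3: "cond_A3 \<rho>"
  shows "mean_loss \<rho> (contaminant L \<alpha>0 \<theta>0) \<alpha> \<theta> s =
    (\<integral>w. \<rho> ((L * w * (norm \<theta>0 - sgn \<theta>0 \<bullet> \<theta>) - (\<alpha> - \<alpha>0)) / s) \<partial>F)"
proof -
  have eq: "L * w * norm \<theta>0 + \<alpha>0 - \<alpha> - (L * w) *\<^sub>R sgn \<theta>0 \<bullet> \<theta> =
      L * w * (norm \<theta>0 - sgn \<theta>0 \<bullet> \<theta>) - (\<alpha> - \<alpha>0)" for w
    by (simp add: algebra_simps)
  let ?g = "\<lambda>w. (L * w * norm \<theta>0 + \<alpha>0, (L * w) *\<^sub>R sgn \<theta>0)"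
  have "mean_loss \<rho> (contaminant L \<alpha>0 \<theta>0) \<alpha> \<theta> s =
      (\<integral>w. \<rho> ((fst (?g w) - \<alpha> - snd (?g w) \<bullet> \<theta>) / s) \<partial>F)"
    unfolding mean_loss_def contaminant_def
    by (rule integral_distr[OF contaminant_measurable residual_loss_measurable[OF A3]])
  thus ?thesis unfolding fst_conv snd_conv eq .
qed

lemma mean_loss_contaminant_exact_fit:
  assumes "cond_A3 \<rho>"
  shows "mean_loss \<rho> (contaminant L \<alpha> \<theta>) \<alpha> \<theta> s = 0"
proof -
  have "sgn \<theta> \<bullet> \<theta> = norm \<theta>"
    by (cases "\<theta> = 0") (simp_all add: sgn_div_norm dot_square_norm power2_eq_square)
  thus ?thesis using assms by (simp add: mean_loss_contaminant cond_A3_zero)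
qed

text \<open>By Cauchy-Schwarz the coefficient \<open>k\<close> of the affine residual is at least
  \<kappa>. The loss is therefore a \<open>shift_loss\<close> at scale \<open>s / (L * k)\<close>,
  which decreases when the shift is removed and again when the scale grows to
  \<open>s / (L * \<kappa>)\<close>.\<close>

lemma mean_loss_contaminant_ge:
  assumes A3: "cond_A3 \<rho>" "dips \<rho>" and L: "0 < L" and s: "0 < s"
    and \<kappa>: "0 < \<kappa>" "norm \<theta> + \<kappa> \<le> norm \<theta>0"
  shows "shift_loss F \<rho> (s / (L * \<kappa>)) 0 \<le> mean_loss \<rho> (contaminant L \<alpha>0 \<theta>0) \<alpha> \<theta> s"
proof -
  define k where "k = norm \<theta>0 - sgn \<theta>0 \<bullet> \<theta>"
  have "sgn \<theta>0 \<bullet> \<theta> \<le> norm (sgn \<theta>0) * norm \<theta>" by (rule norm_cauchy_schwarz)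
  also have "\<dots> \<le> norm \<theta>" by (simp add: norm_sgn)
  finally have k: "\<kappa> \<le> k" using \<kappa> by (simp add: k_def)
  have Lk: "0 < L * \<kappa>" "L * \<kappa> \<le> L * k" "0 < L * k" using k \<kappa> L by auto
  have "shift_loss F \<rho> (s / (L * \<kappa>)) 0 \<le> shift_loss F \<rho> (s / (L * k)) 0"
    using Lk s by (intro shift_loss_antimono_scale A3) (auto intro!: divide_left_mono)
  also have "\<dots> \<le> shift_loss F \<rho> (s / (L * k)) ((\<alpha> - \<alpha>0) / (L * k))"
    using Lk s by (intro shift_loss_mono A3) auto
  also have "\<dots> = mean_loss \<rho> (contaminant L \<alpha>0 \<theta>0) \<alpha> \<theta> s"
    unfolding mean_loss_contaminant[OF A3(1)] shift_loss_def k_def[symmetric]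
  proof (intro Bochner_Integration.integral_cong refl)
    fix w
    have "(w - (\<alpha> - \<alpha>0) / (L * k)) / (s / (L * k)) = (L * w * k - (\<alpha> - \<alpha>0)) / s"
    proof -
      have "(w - a / q) / (s / q) = (q * w - a) / s" if "0 < q" for a q
        using that s by (simp add: field_simps)
      from this[OF Lk(3), of "\<alpha> - \<alpha>0"] show ?thesis by (simp only: mult.commute mult.left_commute)
    qed
    thus "\<rho> ((w - (\<alpha> - \<alpha>0) / (L * k)) / (s / (L * k))) = \<rho> ((L * w * k - (\<alpha> - \<alpha>0)) / s)" by (simp only:)
  qed
  finally show ?thesis .
qed

end

section \<open>S-scales over the contamination neighbourhood\<close>

text \<open>\<open>B\<close> is a real bound on the S-bias. Since an undefined estimate has infinite
  bias, it also ensures that the S-problem is solvable throughout the neighbourhood.\<close>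

locale mm_setting = central_model F f G for F f and G :: "(real ^ 'p) measure" +
  fixes \<rho>1 \<rho>2 :: "real \<Rightarrow> real" and b \<epsilon> B :: real
    and T_S :: "(real \<times> (real ^ 'p)) measure \<Rightarrow> (real ^ 'p) option"
  assumes A3_1: "cond_A3 \<rho>1" and A3_2: "cond_A3 \<rho>2" and \<rho>_le: "\<rho>2 u \<le> \<rho>1 u"
    and b_def: "b = (\<integral>y. \<rho>1 y \<partial>F)"
    and \<epsilon>_pos: "0 < \<epsilon>" and \<epsilon>_less_b: "\<epsilon> < b" and \<epsilon>_less: "\<epsilon> < 1 - b"
    and T_S: "S_slope_estimate \<rho>1 b T_S"
    and T_S_bias: "H \<in> contam_nbhd \<epsilon> Ho \<Longrightarrow> bias T_S H \<le> ereal B"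
begin

lemma b_bounds: "0 < b" "b < 1" "0 < 1 - \<epsilon>" "\<epsilon> < 1"
  using \<epsilon>_pos \<epsilon>_less_b \<epsilon>_less by auto

lemma nbhd_eq: "contam_nbhd \<epsilon> Ho = mixture \<epsilon> Ho ` distributions"
  using \<epsilon>_pos b_bounds by (intro contam_nbhd_eq Ho_distribution) auto

lemma contaminated_in_nbhd: "mixture \<epsilon> Ho (contaminant L \<alpha> \<theta>) \<in> contam_nbhd \<epsilon> Ho"
  unfolding nbhd_eq using contaminant_distribution by blast

lemma nbhd_nonempty: "contam_nbhd \<epsilon> Ho \<noteq> {}"
  using contaminated_in_nbhd by blast

text \<open>Otherwise \<open>\<rho>1\<close> would equal 1 off the origin, making \<open>b = 1\<close>.\<close>

lemma dips_1: "dips \<rho>1"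
proof (rule ccontr)
  assume "\<not> dips \<rho>1"
  hence nd: "\<And>d. 0 < d \<Longrightarrow> \<exists>u. \<bar>u\<bar> < d \<and> 1 \<le> \<rho>1 u" unfolding dips_def by (meson not_le)
  have one: "\<rho>1 y = 1" if "y \<noteq> 0" for y
  proof -
    obtain u where "\<bar>u\<bar> < \<bar>y\<bar>" "1 \<le> \<rho>1 u" using nd[of "\<bar>y\<bar>"] \<open>y \<noteq> 0\<close> by auto
    moreover have "\<rho>1 u \<le> \<rho>1 y" using calculation by (intro cond_A3_mono[OF A3_1]) simp
    ultimately show ?thesis using cond_A3_le_1[OF A3_1, of y] by simp
  qed
  have "AE y in F. y \<noteq> 0" unfolding AE_F_iff by (rule AE_lborel_singleton)
  hence "(\<integral>y. \<rho>1 y \<partial>F) = (\<integral>y. 1 \<partial>F)"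
    using cond_A3_measurable[OF A3_1] one by (intro integral_cong_AE) (auto elim: eventually_mono)
  thus False using b_bounds b_def by (simp add: prob_space)
qed

lemma dips_2: "dips \<rho>2"
  using dips_1 \<rho>_le unfolding dips_def by (meson le_less_trans)

lemma mean_loss_nbhd:
  assumes "cond_A3 \<rho>" "Q \<in> distributions"
  shows "mean_loss \<rho> (mixture \<epsilon> Ho Q) \<alpha> \<theta> \<sigma> =
    (1 - \<epsilon>) * mean_loss \<rho> Ho \<alpha> \<theta> \<sigma> + \<epsilon> * mean_loss \<rho> Q \<alpha> \<theta> \<sigma>"
  using assms \<epsilon>_pos b_bounds by (intro mean_loss_mixture Ho_distribution) auto

lemma S_solution_nbhd:
  assumes H: "H \<in> contam_nbhd \<epsilon> Ho"
  obtains \<alpha> \<theta> where "S_solution \<rho>1 b H \<alpha> \<theta> (S_scale \<rho>1 b H)" "norm \<theta> \<le> B"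
proof -
  have dist: "H \<in> distributions" using H by (simp add: contam_nbhd_def)
  obtain \<theta> where \<theta>: "T_S H = Some \<theta>" "norm \<theta> \<le> B"
    using T_S_bias[OF H] by (auto simp: bias_def split: option.splits)
  then obtain \<alpha> \<sigma> where sol: "S_solution \<rho>1 b H \<alpha> \<theta> \<sigma>"
    using T_S dist by (auto simp: S_slope_estimate_def dest!: bspec[of _ _ H])
  show ?thesis using that sol \<theta> S_scale_eq[OF sol] by auto
qed

lemma B_nonneg: "0 \<le> B"
proof -
  obtain H where "H \<in> contam_nbhd \<epsilon> Ho" using nbhd_nonempty by blast
  from S_solution_nbhd[OF this] show ?thesis by (metis norm_ge_zero order_trans)
qed

lemma S_scale_pos:
  assumes "H \<in> contam_nbhd \<epsilon> Ho"
  shows "0 < S_scale \<rho>1 b H"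
  using S_solution_nbhd[OF assms] by (metis S_solution_def)

lemma S_scale_le:
  assumes "H \<in> contam_nbhd \<epsilon> Ho" "0 < \<sigma>" "mean_loss \<rho>1 H \<alpha> \<theta> \<sigma> \<le> b"
  shows "S_scale \<rho>1 b H \<le> \<sigma>"
  using S_solution_nbhd[OF assms(1)] assms(2,3) by (metis S_solution_def)

text \<open>Below the S-scale even the fit \<open>(0, 0)\<close> is infeasible, and contamination
  contributes at most \<epsilon> to its loss.\<close>

lemma below_S_scale:
  assumes H: "H \<in> contam_nbhd \<epsilon> Ho" and \<sigma>: "0 < \<sigma>" "\<sigma> < S_scale \<rho>1 b H"
  shows "b < (1 - \<epsilon>) * shift_loss F \<rho>1 \<sigma> 0 + \<epsilon>"
proof -
  obtain Q where Q: "Q \<in> distributions" "H = mixture \<epsilon> Ho Q" using H by (auto simp: nbhd_eq)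
  have "b < mean_loss \<rho>1 H 0 0 \<sigma>" using S_scale_le[OF H \<sigma>(1)] \<sigma>(2) by (meson not_le)
  also have "\<dots> = (1 - \<epsilon>) * shift_loss F \<rho>1 \<sigma> 0 + \<epsilon> * mean_loss \<rho>1 Q 0 0 \<sigma>"
    using Q by (simp add: mean_loss_nbhd A3_1 mean_loss_Ho_zero)
  also have "\<dots> \<le> (1 - \<epsilon>) * shift_loss F \<rho>1 \<sigma> 0 + \<epsilon>"
    using mean_loss_bounds(2)[OF Q(1) A3_1] \<epsilon>_pos by (simp add: mult_left_le)
  finally show ?thesis .
qed

lemma mean_loss_contaminated_ge:
  assumes "cond_A3 \<rho>" "dips \<rho>" "0 < L" "0 < s" "0 < \<kappa>" "norm \<theta> + \<kappa> \<le> norm \<theta>0"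
  shows "(1 - \<epsilon>) * shift_loss F \<rho> s 0 + \<epsilon> * shift_loss F \<rho> (s / (L * \<kappa>)) 0
    \<le> mean_loss \<rho> (mixture \<epsilon> Ho (contaminant L \<alpha>0 \<theta>0)) \<alpha> \<theta> s"
  using assms \<epsilon>_pos b_bounds
  by (simp add: mean_loss_nbhd contaminant_distribution)
     (intro add_mono mult_left_mono mean_loss_Ho_ge mean_loss_contaminant_ge, auto)

lemma mean_loss_contaminated_exact_fit:
  assumes "cond_A3 \<rho>"
  shows "mean_loss \<rho> (mixture \<epsilon> Ho (contaminant L \<alpha> \<theta>)) \<alpha> \<theta> s = (1 - \<epsilon>) * mean_loss \<rho> Ho \<alpha> \<theta> s"
  using assms by (simp add: mean_loss_nbhd contaminant_distribution mean_loss_contaminant_exact_fit)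

text \<open>An S-slope has norm at most \<open>B\<close>, so it misses a hyperplane whose slope is
  longer by \<kappa>; the lower bound on its loss meets the constraint \<open>b\<close>.\<close>

lemma S_scale_contaminated:
  fixes \<alpha>0 :: real and \<theta>0 :: "real ^ 'p"
  assumes L: "0 < L" and \<kappa>: "0 < \<kappa>" "B + \<kappa> \<le> norm \<theta>0"
  defines "H \<equiv> mixture \<epsilon> Ho (contaminant L \<alpha>0 \<theta>0)"
  shows "(1 - \<epsilon>) * shift_loss F \<rho>1 (S_scale \<rho>1 b H) 0
    + \<epsilon> * shift_loss F \<rho>1 (S_scale \<rho>1 b H / (L * \<kappa>)) 0 \<le> b"
proof -
  have H: "H \<in> contam_nbhd \<epsilon> Ho" unfolding H_def by (rule contaminated_in_nbhd)
  obtain \<alpha> \<theta> where sol: "S_solution \<rho>1 b H \<alpha> \<theta> (S_scale \<rho>1 b H)" "norm \<theta> \<le> B"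
    using S_solution_nbhd[OF H] .
  hence "mean_loss \<rho>1 H \<alpha> \<theta> (S_scale \<rho>1 b H) \<le> b" by (simp add: S_solution_def)
  thus ?thesis
    using mean_loss_contaminated_ge[OF A3_1 dips_1 L S_scale_pos[OF H] \<kappa>(1), of \<theta> \<theta>0 \<alpha>0 \<alpha>] sol \<kappa>
    by (simp add: H_def)
qed

text \<open>A jump of \<open>\<rho>1\<close> at the origin keeps the loss from vanishing at large scales, but its limit is at
  most \<open>b\<close> because \<open>b\<close> dominates the height of the jump.\<close>

lemma exists_large_scale: "\<exists>\<sigma>>0. (1 - \<epsilon>) * mean_loss \<rho>1 Ho 0 \<theta> \<sigma> \<le> b"
proof -
  \<comment> \<open>The right-hand limit of \<rho>1 at 0, that is, the height of the jump.\<close>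
  define c where "c = (INF u\<in>{0<..}. \<rho>1 u)"
  have bdd: "bdd_below (\<rho>1 ` {0<..})" using cond_A3_nonneg[OF A3_1] by (auto intro!: bdd_belowI2)
  have c_le': "c \<le> \<rho>1 u" if "0 < u" for u unfolding c_def using that bdd by (intro cINF_lower) auto
  have c_le: "c \<le> \<rho>1 u" if "u \<noteq> 0" for u
    using c_le'[of "\<bar>u\<bar>"] that cond_A3_mono[OF A3_1, of "\<bar>u\<bar>" u] by auto
  have c0: "0 \<le> c" unfolding c_def by (intro cINF_greatest cond_A3_nonneg[OF A3_1]) auto
  have cb: "c \<le> b"
  proof -
    have "AE y in F. y \<noteq> 0" unfolding AE_F_iff by (rule AE_lborel_singleton)
    hence "AE y in F. c \<le> \<rho>1 y" by (rule eventually_mono) (rule c_le)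
    moreover have "integrable F \<rho>1" using integrable_shift[OF A3_1, of 0 1] by simp
    ultimately show ?thesis unfolding b_def by (intro integral_ge_const)
  qed
  have lim: "(\<lambda>n. \<rho>1 (u / real (Suc n))) \<longlonglongrightarrow> (if u = 0 then 0 else c)" for u
  proof (cases "u = 0")
    case True thus ?thesis by (simp add: cond_A3_zero[OF A3_1])
  next
    case False
    have "(\<lambda>n. \<rho>1 (u / real (Suc n))) \<longlonglongrightarrow> c"
    proof (rule order_tendstoI)
      fix a assume "a < c"
      thus "\<forall>\<^sub>F n in sequentially. a < \<rho>1 (u / real (Suc n))"
        using c_le False by (intro always_eventually allI) (force intro: less_le_trans)
    next
      fix a assume "c < a"
      then obtain r where r: "0 < r" "\<rho>1 r < a"
        unfolding c_def using bdd by (subst (asm) cINF_less_iff) auto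
      have "(\<lambda>n. \<bar>u\<bar> * inverse (real (Suc n))) \<longlonglongrightarrow> \<bar>u\<bar> * 0"
        by (intro tendsto_mult tendsto_const LIMSEQ_inverse_real_of_nat)
      hence "\<forall>\<^sub>F n in sequentially. \<bar>u\<bar> * inverse (real (Suc n)) < r"
        using r by (intro order_tendstoD) auto
      thus "\<forall>\<^sub>F n in sequentially. \<rho>1 (u / real (Suc n)) < a"
      proof eventually_elim
        case (elim n)
        have "\<rho>1 (u / real (Suc n)) \<le> \<rho>1 r"
          using elim r by (intro cond_A3_mono[OF A3_1]) (simp add: divide_inverse abs_mult)
        thus ?case using r by simp
      qed
    qed
    thus ?thesis using False by simp
  qed
  interpret Ho: prob_space Ho using Ho_distribution by (simp add: distributions_def)
  have sets: "sets Ho = sets borel" using Ho_distribution by (simp add: distributions_def)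
  define res where "res z = fst z - snd z \<bullet> \<theta>" for z :: "real \<times> (real ^ 'p)"
  have res: "res \<in> borel_measurable Ho"
  proof -
    have "continuous_on UNIV res" unfolding res_def by (intro continuous_intros)
    thus ?thesis using borel_measurable_continuous_onI sets by (simp cong: measurable_cong_sets)
  qed
  \<comment> \<open>As the scale grows, only the jump survives: the limiting loss is 0 on the
    hyperplane and \<open>c\<close> off it.\<close>
  have lim_Ho: "(\<lambda>n. mean_loss \<rho>1 Ho 0 \<theta> (real (Suc n))) \<longlonglongrightarrow> (\<integral>z. (if res z = 0 then 0 else c) \<partial>Ho)"
    unfolding mean_loss_def
  proof (rule integral_dominated_convergence[where w = "\<lambda>_. 1"])
    show "(\<lambda>z. if res z = 0 then 0 else c) \<in> borel_measurable Ho" using res by measurable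
    show "(\<lambda>z. \<rho>1 ((fst z - 0 - snd z \<bullet> \<theta>) / real (Suc n))) \<in> borel_measurable Ho" for n
      using residual_loss_measurable[OF A3_1, of 0 \<theta> "real (Suc n)"] sets
      by (simp cong: measurable_cong_sets)
    show "AE z in Ho. (\<lambda>n. \<rho>1 ((fst z - 0 - snd z \<bullet> \<theta>) / real (Suc n))) \<longlonglongrightarrow> (if res z = 0 then 0 else c)"
      using lim[of "res z" for z] by (simp add: res_def)
  qed (auto simp: cond_A3_norm[OF A3_1])
  have "(\<integral>z. (if res z = 0 then 0 else c) \<partial>Ho) \<le> b"
  proof (rule Ho.integral_le_const)
    show "integrable Ho (\<lambda>z. if res z = 0 then 0 else c)"
      using res c0 by (intro Ho.integrable_const_bound[where B = c]) auto
  qed (use cb b_bounds in auto)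
  also have "b < b / (1 - \<epsilon>)" using b_bounds \<epsilon>_pos by (simp add: field_simps)
  finally obtain n where "mean_loss \<rho>1 Ho 0 \<theta> (real (Suc n)) < b / (1 - \<epsilon>)"
    using order_tendstoD(2)[OF lim_Ho] by (auto simp: eventually_sequentially)
  thus ?thesis using b_bounds by (intro exI[of _ "real (Suc n)"]) (auto simp: field_simps)
qed

lemma shift_loss_spread:
  assumes "cond_A3 \<rho>" "0 < s" "0 < \<kappa>"
  shows "(\<lambda>n. shift_loss F \<rho> (s / (real (Suc n) * \<kappa>)) 0) \<longlonglongrightarrow> 1"
  using shift_loss_small_scale[OF assms(1), of "s / \<kappa>"] assms by (simp add: field_simps)

text \<open>If the S-scale were unbounded, a widely spread contamination lying exactly on a steep
  hyperplane would force the S-estimate of the slopes beyond its bound \<open>B\<close>.\<close>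

lemma bdd_above_S_scale: "bdd_above (S_scale \<rho>1 b ` contam_nbhd \<epsilon> Ho)"
proof (rule ccontr)
  assume unb: "\<not> ?thesis"
  obtain \<theta>0 :: "real ^ 'p" where \<theta>0: "norm \<theta>0 = B + 1" using vector_choose_size[of "B + 1"] B_nonneg by auto
  \<comment> \<open>At scale \<sigma> the exact fit of the hyperplane is feasible whatever the
    spread, because the contamination then has zero loss.\<close>
  obtain \<sigma> where \<sigma>: "0 < \<sigma>" "(1 - \<epsilon>) * mean_loss \<rho>1 Ho 0 \<theta>0 \<sigma> \<le> b" using exists_large_scale by blast
  obtain H where "H \<in> contam_nbhd \<epsilon> Ho" "\<sigma> < S_scale \<rho>1 b H"
    using unb by (force simp: bdd_above_def not_le)
  hence gt: "b < (1 - \<epsilon>) * shift_loss F \<rho>1 \<sigma> 0 + \<epsilon> * 1" using below_S_scale \<sigma> by simp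
  \<comment> \<open>Wide spread brings the contaminating term close to its full weight \<epsilon>,
    preserving the strict inequality. The factor 1 beside the spread is the gap between
    \<open>norm \<theta>0\<close> and \<open>B\<close>.\<close>
  have "(\<lambda>n. (1 - \<epsilon>) * shift_loss F \<rho>1 \<sigma> 0 + \<epsilon> * shift_loss F \<rho>1 (\<sigma> / (real (Suc n) * 1)) 0)
    \<longlonglongrightarrow> (1 - \<epsilon>) * shift_loss F \<rho>1 \<sigma> 0 + \<epsilon> * 1"
    by (intro tendsto_intros shift_loss_spread A3_1 \<sigma>) simp
  from order_tendstoD(1)[OF this gt] obtain n where
    n: "b < (1 - \<epsilon>) * shift_loss F \<rho>1 \<sigma> 0 + \<epsilon> * shift_loss F \<rho>1 (\<sigma> / (real (Suc n) * 1)) 0"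
    by (auto simp: eventually_sequentially)
  let ?H = "mixture \<epsilon> Ho (contaminant (real (Suc n)) 0 \<theta>0)"
  have "S_scale \<rho>1 b ?H \<le> \<sigma>"
    by (rule S_scale_le[where \<alpha> = 0 and \<theta> = \<theta>0, OF contaminated_in_nbhd \<sigma>(1)])
       (use \<sigma> in \<open>simp only: mean_loss_contaminated_exact_fit[OF A3_1]\<close>)
  moreover note S_scale_pos[OF contaminated_in_nbhd, of "real (Suc n)" 0 \<theta>0]
  ultimately have
    "(1 - \<epsilon>) * shift_loss F \<rho>1 \<sigma> 0 + \<epsilon> * shift_loss F \<rho>1 (\<sigma> / (real (Suc n) * 1)) 0
    \<le> (1 - \<epsilon>) * shift_loss F \<rho>1 (S_scale \<rho>1 b ?H) 0
      + \<epsilon> * shift_loss F \<rho>1 (S_scale \<rho>1 b ?H / (real (Suc n) * 1)) 0"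
    using \<epsilon>_pos b_bounds
    by (intro add_mono mult_left_mono shift_loss_antimono_scale A3_1 divide_right_mono) auto
  also have "\<dots> \<le> b" using \<theta>0 by (intro S_scale_contaminated) auto
  finally show False using n by simp
qed

lemma S_scale_le_sup: "H \<in> contam_nbhd \<epsilon> Ho \<Longrightarrow> S_scale \<rho>1 b H \<le> scale_sup \<rho>1 b Ho \<epsilon>"
  unfolding scale_sup_def by (intro cSUP_upper bdd_above_S_scale)

lemma scale_inf_le:
  assumes "H \<in> contam_nbhd \<epsilon> Ho"
  shows "scale_inf \<rho>1 b Ho \<epsilon> \<le> S_scale \<rho>1 b H"
  unfolding scale_inf_def
  by (intro cINF_lower assms bdd_belowI2[of _ 0] less_imp_le S_scale_pos)

lemma scale_inf_nonneg: "0 \<le> scale_inf \<rho>1 b Ho \<epsilon>"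
  unfolding scale_inf_def by (intro cINF_greatest nbhd_nonempty less_imp_le S_scale_pos)

lemma scale_sup_pos: "0 < scale_sup \<rho>1 b Ho \<epsilon>"
  using S_scale_pos S_scale_le_sup nbhd_nonempty by (meson all_not_in_conv less_le_trans)

lemma scale_inf_le_sup: "scale_inf \<rho>1 b Ho \<epsilon> \<le> scale_sup \<rho>1 b Ho \<epsilon>"
  using scale_inf_le S_scale_le_sup nbhd_nonempty by (meson all_not_in_conv order_trans)

text \<open>Were the scale to stay below some \<sigma> less than the supremum, the loss at wide
  spread would exceed \<open>b\<close>, which \<open>S_scale_contaminated\<close> excludes.\<close>

lemma S_scale_contaminated_tendsto:
  assumes \<theta>0: "B < norm \<theta>0"
  shows "(\<lambda>n. S_scale \<rho>1 b (mixture \<epsilon> Ho (contaminant (real (Suc n)) \<alpha>0 \<theta>0))) \<longlonglongrightarrow> scale_sup \<rho>1 b Ho \<epsilon>"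
    (is "?s \<longlonglongrightarrow> ?S")
proof (rule order_tendstoI)
  fix a assume "?S < a"
  thus "\<forall>\<^sub>F n in sequentially. ?s n < a"
    using S_scale_le_sup[OF contaminated_in_nbhd] by (intro always_eventually allI) (blast intro: le_less_trans)
next
  fix a assume "a < ?S"
  \<comment> \<open>The maximum with half the supremum keeps \<sigma> positive even when
    \<open>a\<close> is not.\<close>
  define \<sigma> where "\<sigma> = max a (?S / 2)"
  have \<sigma>: "0 < \<sigma>" "a \<le> \<sigma>" "\<sigma> < ?S" using \<open>a < ?S\<close> scale_sup_pos by (auto simp: \<sigma>_def)
  define \<kappa> where "\<kappa> = norm \<theta>0 - B"
  have \<kappa>: "0 < \<kappa>" "B + \<kappa> \<le> norm \<theta>0" using \<theta>0 by (auto simp: \<kappa>_def)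
  obtain H where "H \<in> contam_nbhd \<epsilon> Ho" "\<sigma> < S_scale \<rho>1 b H"
    using \<sigma>(3) unfolding scale_sup_def less_cSUP_iff[OF nbhd_nonempty bdd_above_S_scale] by auto
  hence gt: "b < (1 - \<epsilon>) * shift_loss F \<rho>1 \<sigma> 0 + \<epsilon> * 1" using below_S_scale \<sigma> by simp
  have "(\<lambda>n. (1 - \<epsilon>) * shift_loss F \<rho>1 \<sigma> 0 + \<epsilon> * shift_loss F \<rho>1 (?S / (real (Suc n) * \<kappa>)) 0)
    \<longlonglongrightarrow> (1 - \<epsilon>) * shift_loss F \<rho>1 \<sigma> 0 + \<epsilon> * 1"
    by (intro tendsto_intros shift_loss_spread A3_1 scale_sup_pos \<kappa>)
  from order_tendstoD(1)[OF this gt]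
  show "\<forall>\<^sub>F n in sequentially. a < ?s n"
  proof eventually_elim
    case (elim n)
    show ?case
    proof (rule ccontr)
      assume "\<not> a < ?s n"
      hence "?s n \<le> \<sigma>" using \<sigma> by simp
      moreover have "0 < ?s n" "?s n \<le> ?S" by (intro S_scale_pos S_scale_le_sup contaminated_in_nbhd)+
      \<comment> \<open>Both scales on the right are smaller than those on the left, so both losses
        are larger.\<close>
      ultimately have "(1 - \<epsilon>) * shift_loss F \<rho>1 \<sigma> 0 + \<epsilon> * shift_loss F \<rho>1 (?S / (real (Suc n) * \<kappa>)) 0
        \<le> (1 - \<epsilon>) * shift_loss F \<rho>1 (?s n) 0 + \<epsilon> * shift_loss F \<rho>1 (?s n / (real (Suc n) * \<kappa>)) 0"
        using \<epsilon>_pos b_bounds \<kappa>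
        by (intro add_mono mult_left_mono shift_loss_antimono_scale A3_1 divide_right_mono) auto
      also have "\<dots> \<le> b" by (intro S_scale_contaminated \<kappa>) simp
      finally show False using elim by simp
    qed
  qed
qed

section \<open>Upper and lower bounds for the MM-slopes\<close>

text \<open>A slope longer than \<open>t\<close> would have excess at most
  \<open>\<epsilon> / (1 - \<epsilon>)\<close>; shrunk to length \<open>t\<close> it would fall
  strictly below that value, which is the infimum at \<open>t\<close>.\<close>

lemma MM_slope_le:
  assumes T_MM: "MM_slope_estimate \<rho>1 \<rho>2 b T_MM" and H: "H \<in> contam_nbhd \<epsilon> Ho" and T: "T_MM H = Some \<theta>"
    and inf_pos: "0 < scale_inf \<rho>1 b Ho \<epsilon>" and t: "0 \<le> t"
    and v: "inf_m \<rho>2 Ho {scale_inf \<rho>1 b Ho \<epsilon>..scale_sup \<rho>1 b Ho \<epsilon>} t = \<epsilon> / (1 - \<epsilon>)"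
  shows "norm \<theta> \<le> t"
proof (rule ccontr)
  assume "\<not> ?thesis"
  hence gt: "t < norm \<theta>" by simp
  obtain Q where Q: "Q \<in> distributions" "H = mixture \<epsilon> Ho Q" using H by (auto simp: nbhd_eq)
  define s where "s = S_scale \<rho>1 b H"
  have s: "s \<in> {scale_inf \<rho>1 b Ho \<epsilon>..scale_sup \<rho>1 b Ho \<epsilon>}"
    using scale_inf_le[OF H] S_scale_le_sup[OF H] by (simp add: s_def)
  have "H \<in> distributions" using H by (simp add: contam_nbhd_def)
  then obtain \<alpha> where "MM_solution \<rho>1 \<rho>2 b H \<alpha> \<theta>"
    using T_MM T by (auto simp: MM_slope_estimate_def dest!: bspec[of _ _ H])
  hence "mean_loss \<rho>2 H \<alpha> \<theta> s \<le> mean_loss \<rho>2 H 0 0 s" by (simp add: MM_solution_def s_def)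
  \<comment> \<open>Both mean losses under \<open>H\<close> are split into central and contaminating
    parts.\<close>
  hence "(1 - \<epsilon>) * excess \<rho>2 \<alpha> \<theta> s \<le> \<epsilon> * (mean_loss \<rho>2 Q 0 0 s - mean_loss \<rho>2 Q \<alpha> \<theta> s)"
    using Q A3_2 by (simp add: mean_loss_nbhd excess_def algebra_simps)
  also have "\<dots> \<le> \<epsilon> * 1"
    using \<epsilon>_pos mean_loss_bounds[OF Q(1) A3_2, of 0 0 s] mean_loss_bounds[OF Q(1) A3_2, of \<alpha> \<theta> s]
    by (intro mult_left_mono) auto
  finally have le: "excess \<rho>2 \<alpha> \<theta> s \<le> \<epsilon> / (1 - \<epsilon>)"
    using b_bounds by (simp add: field_simps)
  have "0 < s" using S_scale_pos[OF H] by (simp add: s_def)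
  from excess_strict[OF A3_2 dips_2 this t gt] obtain \<alpha>' \<theta>'
    where "norm \<theta>' = t" "excess \<rho>2 \<alpha>' \<theta>' s < excess \<rho>2 \<alpha> \<theta> s" by blast
  with inf_m_le[OF A3_2 s, of \<theta>' \<alpha>'] le v show False by simp
qed

lemma MM_bias_ge:
  assumes T_MM: "MM_slope_estimate \<rho>1 \<rho>2 b T_MM"
    and t: "B < t" and v: "inf_m \<rho>2 Ho {scale_sup \<rho>1 b Ho \<epsilon>} t = \<epsilon> / (1 - \<epsilon>)"
    and C: "\<And>H. H \<in> contam_nbhd \<epsilon> Ho \<Longrightarrow> bias T_MM H \<le> ereal C"
  shows "t \<le> C"
proof (rule ccontr)
  assume "\<not> ?thesis"
  hence Ct: "C < t" by simp
  let ?S = "scale_sup \<rho>1 b Ho \<epsilon>"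
  define M where "M = max B C"
  \<comment> \<open>Half the distance from the larger of the two bounds to \<open>t\<close>: the
    midpoint \<open>t'\<close> exceeds every S- and MM-slope by at least \<kappa>, yet stays below
    \<open>t\<close>.\<close>
  define \<kappa> where "\<kappa> = (t - M) / 2"
  define t' where "t' = M + \<kappa>"
  have M: "B \<le> M" "C \<le> M" "M < t" using Ct t by (auto simp: M_def)
  have t': "0 \<le> t'" "t' < t" "B < t'" and \<kappa>: "0 < \<kappa>" "C + \<kappa> \<le> t'"
    using M B_nonneg by (auto simp: t'_def \<kappa>_def field_simps)
  have "inf_m \<rho>2 Ho {?S} t' < \<epsilon> / (1 - \<epsilon>)"
    using inf_m_strict_mono[OF A3_2 dips_2, of "{?S}" t' t] scale_sup_pos t' v by simp
  \<comment> \<open>Strict monotonicity supplies a hyperplane of slope length \<open>t'\<close>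
    whose excess at the largest scale is too small; the contamination is placed on it.\<close>
  then obtain \<alpha>0 \<theta>0 where \<theta>0: "norm \<theta>0 = t'" and less: "excess \<rho>2 \<alpha>0 \<theta>0 ?S < \<epsilon> / (1 - \<epsilon>)"
    using inf_m_less_obtain[OF A3_2 t'(1), of "{?S}"] by blast
  define H where "H n = mixture \<epsilon> Ho (contaminant (real (Suc n)) \<alpha>0 \<theta>0)" for n
  define s where "s n = S_scale \<rho>1 b (H n)" for n
  have HN: "H n \<in> contam_nbhd \<epsilon> Ho" for n unfolding H_def by (rule contaminated_in_nbhd)
  have s: "0 < s n" "s n \<le> ?S" for n using S_scale_pos[OF HN] S_scale_le_sup[OF HN] by (auto simp: s_def)
  have s_lim: "s \<longlonglongrightarrow> ?S"
    using S_scale_contaminated_tendsto[of \<theta>0 \<alpha>0] \<theta>0 t' unfolding s_def H_def by simp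
  have "(1 - \<epsilon>) * shift_loss F \<rho>2 (s n) 0 + \<epsilon> * shift_loss F \<rho>2 (?S / (real (Suc n) * \<kappa>)) 0
      \<le> (1 - \<epsilon>) * mean_loss \<rho>2 Ho \<alpha>0 \<theta>0 (s n)" for n
  proof -
    obtain \<theta> where \<theta>: "T_MM (H n) = Some \<theta>" "norm \<theta> \<le> C"
      using C[OF HN, of n] by (auto simp: bias_def split: option.splits)
    have "H n \<in> distributions" using HN by (simp add: contam_nbhd_def)
    then obtain \<alpha> where MM: "MM_solution \<rho>1 \<rho>2 b (H n) \<alpha> \<theta>"
      using T_MM \<theta> by (auto simp: MM_slope_estimate_def dest!: bspec[of _ _ "H n"])
    \<comment> \<open>Replacing \<open>s n\<close> by the larger \<open>?S\<close> lowers the spread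
      term and leaves a sequence with known limit 1.\<close>
    have "(1 - \<epsilon>) * shift_loss F \<rho>2 (s n) 0 + \<epsilon> * shift_loss F \<rho>2 (?S / (real (Suc n) * \<kappa>)) 0
        \<le> (1 - \<epsilon>) * shift_loss F \<rho>2 (s n) 0 + \<epsilon> * shift_loss F \<rho>2 (s n / (real (Suc n) * \<kappa>)) 0"
      using \<epsilon>_pos \<kappa> s
      by (intro add_left_mono mult_left_mono shift_loss_antimono_scale A3_2 divide_right_mono) auto
    also have "\<dots> \<le> mean_loss \<rho>2 (H n) \<alpha> \<theta> (s n)"
      unfolding H_def using s \<theta> \<theta>0 \<kappa> by (intro mean_loss_contaminated_ge A3_2 dips_2) auto
    also have "\<dots> \<le> mean_loss \<rho>2 (H n) \<alpha>0 \<theta>0 (s n)"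
      using MM by (simp add: MM_solution_def s_def)
    also have "\<dots> = (1 - \<epsilon>) * mean_loss \<rho>2 Ho \<alpha>0 \<theta>0 (s n)"
      unfolding H_def by (rule mean_loss_contaminated_exact_fit[OF A3_2])
    finally show ?thesis .
  qed
  moreover have "(\<lambda>n. (1 - \<epsilon>) * shift_loss F \<rho>2 (s n) 0 + \<epsilon> * shift_loss F \<rho>2 (?S / (real (Suc n) * \<kappa>)) 0)
      \<longlonglongrightarrow> (1 - \<epsilon>) * shift_loss F \<rho>2 ?S 0 + \<epsilon> * 1"
    by (intro tendsto_add tendsto_mult tendsto_const shift_loss_spread A3_2 \<kappa> scale_sup_pos
        shift_loss_tendsto s_lim)
  moreover have "(\<lambda>n. (1 - \<epsilon>) * mean_loss \<rho>2 Ho \<alpha>0 \<theta>0 (s n)) \<longlonglongrightarrow> (1 - \<epsilon>) * mean_loss \<rho>2 Ho \<alpha>0 \<theta>0 ?S"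
    by (intro tendsto_mult tendsto_const mean_loss_Ho_tendsto A3_2 scale_sup_pos s_lim)
  \<comment> \<open>In the limit, the hyperplane fit must cost at least the loss of
    \<open>(0, 0)\<close> on the central part plus the full weight \<epsilon>.\<close>
  ultimately have "(1 - \<epsilon>) * shift_loss F \<rho>2 ?S 0 + \<epsilon> * 1 \<le> (1 - \<epsilon>) * mean_loss \<rho>2 Ho \<alpha>0 \<theta>0 ?S"
    by (blast intro: LIMSEQ_le)
  hence "\<epsilon> / (1 - \<epsilon>) \<le> excess \<rho>2 \<alpha>0 \<theta>0 ?S"
    using b_bounds by (simp add: excess_def mean_loss_Ho_zero[OF A3_2] field_simps)
  thus False using less by simp
qed

text \<open>At scale 0 every loss vanishes because \<open>x / 0 = 0\<close>, so \<open>scale_inf = 0\<close> would make \<open>h2\<close> nonpositive.\<close>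

lemma scale_inf_pos:
  assumes t: "0 \<le> t"
    and v: "inf_m \<rho>2 Ho {scale_inf \<rho>1 b Ho \<epsilon>..scale_sup \<rho>1 b Ho \<epsilon>} t = \<epsilon> / (1 - \<epsilon>)"
  shows "0 < scale_inf \<rho>1 b Ho \<epsilon>"
proof (rule ccontr)
  assume "\<not> ?thesis"
  hence "scale_inf \<rho>1 b Ho \<epsilon> = 0" using scale_inf_nonneg by simp
  hence mem: "0 \<in> {scale_inf \<rho>1 b Ho \<epsilon>..scale_sup \<rho>1 b Ho \<epsilon>}" using scale_sup_pos by simp
  obtain \<theta> :: "real ^ 'p" where "norm \<theta> = t" using vector_choose_size[OF t] by auto
  with inf_m_le[OF A3_2 mem, of \<theta> 0] v have "\<epsilon> / (1 - \<epsilon>) \<le> excess \<rho>2 0 \<theta> 0" by simp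
  also have "\<dots> = 0" by (simp add: excess_def mean_loss_def cond_A3_zero[OF A3_2])
  finally show False using b_bounds \<epsilon>_pos by (simp add: divide_le_0_iff)
qed

end

section \<open>Combination of the two bias bounds\<close>

theorem theorem3p1:
  fixes Fo :: "real measure" and Go :: "(real ^ 'p) measure"
    and Ho :: "(real \<times> (real ^ 'p)) measure"
    and \<rho>1 \<rho>2 :: "real \<Rightarrow> real" and b \<epsilon> :: real
    and T_S T_MM :: "(real \<times> (real ^ 'p)) measure \<Rightarrow> (real ^ 'p) option"
  assumes "Fo \<in> distributions" and "Go \<in> distributions" and "Ho = model Fo Go"
    and "cond_A1 Fo" and "cond_A2 Go"
    and "cond_A3 \<rho>1" and "cond_A3 \<rho>2"
    and "\<forall>u. \<rho>1 u \<ge> \<rho>2 u" and "\<rho>1 \<noteq> \<rho>2"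
    and "b = (\<integral>y. \<rho>1 y \<partial>Fo)"
    and "0 < \<epsilon>" and "\<epsilon> < min b (1 - b)"
    and "S_slope_estimate \<rho>1 b T_S"
    and "MM_slope_estimate \<rho>1 \<rho>2 b T_MM"
    and "\<forall>H \<in> contam_nbhd \<epsilon> Ho. T_MM H \<noteq> None"
    and "\<exists>t\<ge>0. h1 \<rho>1 \<rho>2 b Ho \<epsilon> t = \<epsilon> / (1 - \<epsilon>)"
    and "\<exists>t\<ge>0. h2 \<rho>1 \<rho>2 b Ho \<epsilon> t = \<epsilon> / (1 - \<epsilon>)"
    and "max_bias T_S Ho \<epsilon> < ereal (nonneg_inv (h1 \<rho>1 \<rho>2 b Ho \<epsilon>) (\<epsilon> / (1 - \<epsilon>)))"
  shows "ereal (nonneg_inv (h1 \<rho>1 \<rho>2 b Ho \<epsilon>) (\<epsilon> / (1 - \<epsilon>))) \<le> max_bias T_MM Ho \<epsilon> \<and>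
         max_bias T_MM Ho \<epsilon> \<le> ereal (nonneg_inv (h2 \<rho>1 \<rho>2 b Ho \<epsilon>) (\<epsilon> / (1 - \<epsilon>)))"
proof -
  obtain f where f: "\<And>y. 0 \<le> f y" "Fo = density lborel (\<lambda>y. ennreal (f y))" "\<And>y. f (- y) = f y"
    "continuous_on UNIV f" "strict_antimono_on {0<..} f"
    using assms(4) by (auto simp: cond_A1_def)
  \<comment> \<open>The maximum bias is an extended real; a real number strictly between it and the
    inverse value serves as the bound on the S-slopes.\<close>
  obtain B where B: "max_bias T_S Ho \<epsilon> < ereal B"
    "ereal B < ereal (nonneg_inv (h1 \<rho>1 \<rho>2 b Ho \<epsilon>) (\<epsilon> / (1 - \<epsilon>)))"
    using ereal_dense2[OF assms(18)] by blast
  have bias_le: "bias T H \<le> max_bias T Ho \<epsilon>" if "H \<in> contam_nbhd \<epsilon> Ho"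
    for T H unfolding max_bias_def using that by (rule SUP_upper)
  interpret Fo: prob_space Fo using assms(1) by (simp add: distributions_def)
  interpret mm_setting Fo f Go \<rho>1 \<rho>2 b \<epsilon> B T_S
  proof unfold_locales
    show "bias T_S H \<le> ereal B" if "H \<in> contam_nbhd \<epsilon> (model Fo Go)" for H
      using bias_le[of H T_S] that B(1) assms(3) by auto
  qed (use assms f in auto)
  let ?S = "scale_sup \<rho>1 b Ho \<epsilon>" and ?I = "scale_inf \<rho>1 b Ho \<epsilon>" and ?v = "\<epsilon> / (1 - \<epsilon>)"
  have Ho: "model Fo Go = Ho" by (simp add: assms(3))
  have h1: "h1 \<rho>1 \<rho>2 b Ho \<epsilon> = inf_m \<rho>2 Ho {?S}" by (rule ext) (simp add: h1_def inf_m_def)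
  have h2: "h2 \<rho>1 \<rho>2 b Ho \<epsilon> = inf_m \<rho>2 Ho {?I..?S}" by (rule ext) (simp add: h2_def inf_m_def)
  obtain t1 where t1: "0 \<le> t1" "inf_m \<rho>2 Ho {?S} t1 = ?v" using assms(16) h1 by auto
  obtain t2 where t2: "0 \<le> t2" "inf_m \<rho>2 Ho {?I..?S} t2 = ?v" using assms(17) h2 by auto
  have I: "0 < ?I" using scale_inf_pos[OF t2(1)] t2(2) by (simp add: Ho)
  have inv1: "nonneg_inv (h1 \<rho>1 \<rho>2 b Ho \<epsilon>) ?v = t1"
    using nonneg_inv_inf_m[OF assms(7) dips_2, of "{?S}" t1] t1 scale_sup_pos by (simp add: h1 Ho)
  have inv2: "nonneg_inv (h2 \<rho>1 \<rho>2 b Ho \<epsilon>) ?v = t2"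
  proof -
    have "{?I..?S} \<subseteq> {0<..}" using I by auto
    from nonneg_inv_inf_m[OF assms(7) dips_2 _ _ this t2(1)] t2 scale_inf_le_sup
    show ?thesis by (simp add: h2 Ho)
  qed
  have "max_bias T_MM Ho \<epsilon> \<le> ereal t2"
    unfolding max_bias_def
  proof (rule SUP_least)
    fix H assume H: "H \<in> contam_nbhd \<epsilon> Ho"
    \<comment> \<open>Definedness of the MM-estimate on the neighbourhood rules out infinite
      bias.\<close>
    then obtain \<theta> where \<theta>: "T_MM H = Some \<theta>" using assms(15) by auto
    thus "bias T_MM H \<le> ereal t2"
      using MM_slope_le[OF assms(14), of H \<theta> t2] H I t2 by (simp add: Ho bias_def)
  qed
  moreover have "ereal t1 \<le> max_bias T_MM Ho \<epsilon>"
  proof (rule ccontr)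
    assume "\<not> ?thesis"
    hence "max_bias T_MM Ho \<epsilon> < ereal t1" by simp
    \<comment> \<open>A real bound strictly below \<open>t1\<close> would hold for all MM-slopes,
      against the lower bound.\<close>
    then obtain C where C: "max_bias T_MM Ho \<epsilon> < ereal C" "ereal C < ereal t1"
      using ereal_dense2[of "max_bias T_MM Ho \<epsilon>" "ereal t1"] by blast
    have "bias T_MM H \<le> ereal C" if "H \<in> contam_nbhd \<epsilon> Ho" for H
      using bias_le[OF that, of T_MM] C(1) by auto
    hence "t1 \<le> C" using MM_bias_ge[OF assms(14), of t1 C] B(2) t1 by (simp add: inv1 Ho)
    thus False using C(2) by simp
  qed
  ultimately show ?thesis by (simp add: inv1 inv2)
qed

end
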